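(* Consider $dx_t=\frac1\varepsilon[\mu(t)x_t-x_t^3]dt+\frac{\sigma}{\sqrt\varepsilon}dW_t$ with $\mu(t)=t+O(t^2)$ monotonously increasing on $[t_0,T]$, $t_0<0<T$, and let $\alpha(t,s)=\int_s^t\mu(u)du$. For $\varrho\in[0,2/3)$ define $$\mathcal D(\varrho)=\bigl\{(x,t):\sqrt\varepsilon\le t\le T,\ |x|\le\sqrt{(1-\varrho)\mu(t)}\bigr\}.$$ Assume $\sigma|\log\sigma|^{3/2}=O(\sqrt\varepsilon)$. Then for any $\varrho\in(0,2/3)$, any initial condition $(x_{\sqrt\varepsilon},\sqrt\varepsilon)\in\mathcal D(\varrho)$ and all $t\in(\sqrt\varepsilon,T]$, the first-exit time $\tau_{\mathcal D(\varrho)}$ of $(x_s,s)$ from $\mathcal D(\varrho)$ satisfies $$\mathbb P^{\sqrt\varepsilon,x_{\sqrt\varepsilon}}\{\tau_{\mathcal D(\varrho)}\ge t\}\le C(t,\varepsilon)\frac{|\log\sigma|}{\sigma}\,\frac{e^{-\varrho\,\alpha(t,\sqrt\varepsilon)/\varepsilon}}{\sqrt{1-e^{-2\varrho\,\alpha(t,\sqrt\varepsilon)/\varepsilon}}},\qquad C(t,\varepsilon)=c\,\mu(t)\Bigl(1+\frac{\alpha(t,\sqrt\varepsilon)}{\varepsilon}\Bigr),$$ for some constant $c>0$.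
   Context: $W_t$ standard Brownian motion; $\varepsilon,\sigma>0$ small. The set $\mathcal D(2/3)$ contains the points where the potential $V(x,t)=\tfrac14x^4-\tfrac12\mu(t)x^2$ is concave, and $\mathcal D(0)$ the points between the bottoms of the two wells. *)

theory Defs
  imports "HOL-Probability.Probability"
begin

definition brownian_motion :: "'a measure \<Rightarrow> (real \<Rightarrow> 'a \<Rightarrow> real) \<Rightarrow> bool" where
  "brownian_motion M W \<longleftrightarrow>
     prob_space M \<and>
     (\<forall>t\<ge>0. W t \<in> borel_measurable M) \<and>
     (\<forall>\<omega>\<in>space M. W 0 \<omega> = 0 \<and> continuous_on {0..} (\<lambda>t. W t \<omega>)) \<and>
     (\<forall>s t. 0 \<le> s \<and> s < t \<longrightarrow>
        distributed M lborel (\<lambda>\<omega>. W t \<omega> - W s \<omega>)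
          (\<lambda>y. ennreal (normal_density 0 (sqrt (t - s)) y))) \<and>
     (\<forall>(n::nat) (ts::nat \<Rightarrow> real). (0 \<le> ts 0 \<and> (\<forall>i<n. ts i < ts (Suc i))) \<longrightarrow>
        prob_space.indep_vars M (\<lambda>_. borel) (\<lambda>i \<omega>. W (ts (Suc i)) \<omega> - W (ts i) \<omega>) {..<n})"

text \<open>x is a (strong, pathwise) solution on [s0,T] of
  dx = (1/eps) (mu(t) x - x^3) dt + (sig / sqrt eps) dW,  x_{s0} = x0.
Since the noise is additive, the SDE is the pathwise integral equation below.\<close>
definition sde_solution ::
  "'a measure \<Rightarrow> (real \<Rightarrow> 'a \<Rightarrow> real) \<Rightarrow> (real \<Rightarrow> real) \<Rightarrow> real \<Rightarrow> real \<Rightarrow> real \<Rightarrow> real \<Rightarrow> real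
     \<Rightarrow> (real \<Rightarrow> 'a \<Rightarrow> real) \<Rightarrow> bool" where
  "sde_solution M W \<mu> eps sig s0 T x0 x \<longleftrightarrow>
     (\<forall>t\<in>{s0..T}. x t \<in> borel_measurable M) \<and>
     (\<forall>\<omega>\<in>space M. continuous_on {s0..T} (\<lambda>t. x t \<omega>) \<and>
        (\<forall>t\<in>{s0..T}. x t \<omega> = x0
            + integral {s0..t} (\<lambda>u. (\<mu> u * x u \<omega> - (x u \<omega>)^3) / eps)
            + sig / sqrt eps * (W t \<omega> - W s0 \<omega>)))"

definition D_set :: "real \<Rightarrow> real \<Rightarrow> (real \<Rightarrow> real) \<Rightarrow> real \<Rightarrow> (real \<times> real) set" where
  "D_set eps T \<mu> \<rho> = {(x, t). sqrt eps \<le> t \<and> t \<le> T \<and> \<bar>x\<bar> \<le> sqrt ((1 - \<rho>) * \<mu> t)}"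

definition alpha :: "(real \<Rightarrow> real) \<Rightarrow> real \<Rightarrow> real \<Rightarrow> real" where
  "alpha \<mu> t s = integral {s..t} \<mu>"

text \<open>First-exit time from D of (x_s, s), s \<ge> s0 (value \<infinity> if never exits).\<close>
definition first_exit_time :: "(real \<times> real) set \<Rightarrow> real \<Rightarrow> (real \<Rightarrow> 'a \<Rightarrow> real) \<Rightarrow> 'a \<Rightarrow> ereal" where
  "first_exit_time D s0 x \<omega> = (INF s \<in> {s. s0 \<le> s \<and> (x s \<omega>, s) \<notin> D}. ereal s)"

end

theory Submission
  imports Defs
begin

text \<open>In the strip the drift pushes away from \<open>0\<close> at least as strongly as the linear drift
  \<open>\<rho> \<mu>(t) x / \<epsilon>\<close>. For a linear drift a centred Gaussian in \<open>x\<close>, with variance solving the backward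
  equation \<open>v' = 2 \<rho> \<mu> v / \<epsilon> - \<sigma>\<^sup>2 / \<epsilon>\<close>, is an exact space-time harmonic function once suitably
  normalised. Being even and decreasing in \<open>\<bar>x\<bar>\<close>, it is superharmonic for every drift that repels
  from \<open>0\<close> more strongly, so crossings of the axis need no special treatment. Choosing \<open>v = \<mu>(t)\<close> at
  the final time bounds the probability of staying in the strip by a multiple of
  \<open>\<mu>(t) / \<sigma> * e\<^bsup>-\<rho>\<alpha>/\<epsilon>\<^esup> / sqrt (1 - e\<^bsup>-2\<rho>\<alpha>/\<epsilon>\<^esup>)\<close>.

  Stochastic calculus is avoided by working with an Euler scheme, for which the supermartingale
  property reduces to a Gaussian integral. Its drift is modified outside the strip so that the
  comparison with the linear drift holds globally, and on the event of confinement the scheme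
  converges pathwise to the solution.\<close>

section \<open>Gaussian integrals and small-ball bounds for Euler schemes\<close>

text \<open>Up to a constant, the integrand is the centred normal density with standard deviation
  \<open>sqrt v / c\<close>, evaluated at \<open>-m / c - z\<close>. The integral is therefore a
  convolution of two centred normal densities, and the variances add.\<close>

lemma nn_integral_gaussian_shift:
  fixes m c v h :: real
  assumes "0 < c" "0 < v" "0 < h"
  shows "(\<integral>\<^sup>+z. ennreal (exp (-(m + c * z)\<^sup>2 / (2 * v)))
            \<partial>density lborel (\<lambda>z. ennreal (normal_density 0 (sqrt h) z)))
         = ennreal (sqrt (v / (v + c\<^sup>2 * h)) * exp (- m\<^sup>2 / (2 * (v + c\<^sup>2 * h))))"
proof -
  define \<sigma> where "\<sigma> = sqrt v / c"
  have \<sigma>: "\<sigma> > 0" "\<sigma>\<^sup>2 = v / c\<^sup>2" using assms by (auto simp: \<sigma>_def power_divide)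
  have expo: "-(m + c * z)\<^sup>2 / (2 * v) = -(-m / c - z)\<^sup>2 / (2 * \<sigma>\<^sup>2)" for z
  proof -
    have "(-m / c - z)\<^sup>2 = (m + c * z)\<^sup>2 / c\<^sup>2"
      using assms(1) by (simp add: power2_eq_square field_simps)
    then show ?thesis using assms \<sigma> by simp
  qed
  have nd: "exp (-(m + c * z)\<^sup>2 / (2 * v)) = sqrt (2 * pi * \<sigma>\<^sup>2) * normal_density 0 \<sigma> (-m / c - z)" for z
    unfolding expo normal_density_def using \<sigma>(1) by simp
  have "(\<integral>\<^sup>+z. ennreal (exp (-(m + c * z)\<^sup>2 / (2 * v)))
            \<partial>density lborel (\<lambda>z. ennreal (normal_density 0 (sqrt h) z)))
      = (\<integral>\<^sup>+z. ennreal (normal_density 0 (sqrt h) z) * ennreal (exp (-(m + c * z)\<^sup>2 / (2 * v))) \<partial>lborel)"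
    by (subst nn_integral_density) auto
  also have "\<dots> = (\<integral>\<^sup>+z. ennreal (sqrt (2 * pi * \<sigma>\<^sup>2)) *
      ennreal (normal_density 0 \<sigma> (-m / c - z) * normal_density 0 (sqrt h) z) \<partial>lborel)"
    unfolding nd by (intro nn_integral_cong, subst (1 2) ennreal_mult[symmetric]) (auto simp: mult_ac)
  also have "\<dots> = ennreal (sqrt (2 * pi * \<sigma>\<^sup>2)) *
      (\<integral>\<^sup>+z. ennreal (normal_density 0 \<sigma> (-m / c - z) * normal_density 0 (sqrt h) z) \<partial>lborel)"
    by (rule nn_integral_cmult) auto
  also have "(\<integral>\<^sup>+z. ennreal (normal_density 0 \<sigma> (-m / c - z) * normal_density 0 (sqrt h) z) \<partial>lborel)
      = ennreal (normal_density 0 (sqrt (\<sigma>\<^sup>2 + (sqrt h)\<^sup>2)) (-m / c))"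
    using fun_cong[OF conv_normal_density_zero_mean[of \<sigma> "sqrt h"], of "-m/c"] \<sigma>(1) assms by simp
  also have "ennreal (sqrt (2 * pi * \<sigma>\<^sup>2)) * \<dots>
      = ennreal (sqrt (2 * pi * \<sigma>\<^sup>2) * normal_density 0 (sqrt (\<sigma>\<^sup>2 + (sqrt h)\<^sup>2)) (-m / c))"
    by (subst ennreal_mult) auto
  also have "sqrt (2 * pi * \<sigma>\<^sup>2) * normal_density 0 (sqrt (\<sigma>\<^sup>2 + (sqrt h)\<^sup>2)) (-m / c)
      = sqrt (2 * pi * \<sigma>\<^sup>2) / sqrt (2 * pi * (\<sigma>\<^sup>2 + h)) * exp (-(-m/c)\<^sup>2 / (2 * (\<sigma>\<^sup>2 + h)))"
    unfolding normal_density_def using assms by simp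
  also have "sqrt (2 * pi * \<sigma>\<^sup>2) / sqrt (2 * pi * (\<sigma>\<^sup>2 + h)) = sqrt (\<sigma>\<^sup>2 / (\<sigma>\<^sup>2 + h))"
    using assms by (simp add: real_sqrt_divide real_sqrt_mult)
  also have "\<sigma>\<^sup>2 / (\<sigma>\<^sup>2 + h) = v / (v + c\<^sup>2 * h)"
    unfolding \<sigma>(2) using assms by (simp add: field_simps)
  also have "-(-m/c)\<^sup>2 / (2 * (\<sigma>\<^sup>2 + h)) = - m\<^sup>2 / (2 * (v + c\<^sup>2 * h))"
    unfolding \<sigma>(2) using assms by (simp add: field_simps)
  finally show ?thesis .
qed

text \<open>The noise is an explicit argument, so the same deterministic function can be evaluated
  under a Gaussian product measure and along the increments of one Brownian path. \<open>B k\<close>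
  is the drift accumulated over the whole step, with the step size already included.\<close>

primrec euler :: "(nat \<Rightarrow> real \<Rightarrow> real) \<Rightarrow> real \<Rightarrow> real \<Rightarrow> nat \<Rightarrow> (nat \<Rightarrow> real) \<Rightarrow> real" where
  "euler B c x0 0 z = x0"
| "euler B c x0 (Suc k) z = euler B c x0 k z + B k (euler B c x0 k z) + c * z k"

lemma euler_cong:
  "(\<And>i. i < k \<Longrightarrow> z i = z' i) \<Longrightarrow> euler B c x0 k z = euler B c x0 k z'"
  by (induction k) auto

text \<open>The factors are only required to carry the Borel sets, because both products of
  \<open>gauss h\<close> and products of \<open>borel\<close> occur later.\<close>

lemma euler_measurable:
  assumes "\<And>k. B k \<in> borel_measurable borel" "k \<le> n"
    and N: "\<And>i. sets (N i) = sets borel"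
  shows "euler B c x0 k \<in> borel_measurable (PiM {..<n} N)"
  using assms(2)
proof (induction k)
  case 0
  have "euler B c x0 0 = (\<lambda>z. x0)" by auto
  then show ?case by simp
next
  case (Suc k)
  have "(\<lambda>z. z k) \<in> measurable (PiM {..<n} N) (N k)"
    using Suc.prems by (intro measurable_component_singleton) auto
  then have [measurable]: "(\<lambda>z. z k) \<in> borel_measurable (PiM {..<n} N)"
    using measurable_cong_sets[OF refl N] by blast
  have [measurable]: "euler B c x0 k \<in> borel_measurable (PiM {..<n} N)"
    using Suc by simp
  note assms(1)[measurable]
  have "(\<lambda>z. euler B c x0 k z + B k (euler B c x0 k z) + c * z k) \<in> borel_measurable (PiM {..<n} N)"
    by measurable
  then show ?case by simp
qed

abbreviation gauss :: "real \<Rightarrow> real measure" where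
  "gauss h \<equiv> density lborel (\<lambda>z. ennreal (normal_density 0 (sqrt h) z))"

text \<open>Integrating out the last noise variable turns the variance \<open>v'\<close> into
  \<open>v' + c\<^sup>2 * h\<close> and produces the square-root factor. Since the Gaussian
  decreases in the square of its argument, \<open>exp\<close> allows the drift step to be replaced
  by multiplication with \<open>r\<close>, and the equation for \<open>r\<close> turns the result
  into variance \<open>v\<close>.\<close>

lemma euler_gaussian_step:
  fixes B :: "nat \<Rightarrow> real \<Rightarrow> real"
  assumes c: "0 < c" and h: "0 < h" and v: "0 < v" "0 < v'" and r: "v * r\<^sup>2 = v' + c\<^sup>2 * h"
    and exp: "\<And>y. (r * y)\<^sup>2 \<le> (y + B k y)\<^sup>2"
    and B: "\<And>k. B k \<in> borel_measurable borel"
  shows "(\<integral>\<^sup>+z. ennreal (exp (-(euler B c x0 (Suc k) z)\<^sup>2 / (2 * v'))) \<partial>PiM {..<Suc k} (\<lambda>_. gauss h))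
    \<le> ennreal (sqrt (v' / (v' + c\<^sup>2 * h))) *
       (\<integral>\<^sup>+z. ennreal (exp (-(euler B c x0 k z)\<^sup>2 / (2 * v))) \<partial>PiM {..<k} (\<lambda>_. gauss h))"
proof -
  interpret G: prob_space "gauss h"
    using h by (intro prob_space_normal_density) simp
  interpret P: product_sigma_finite "\<lambda>_::nat. gauss h"
    by unfold_locales
  let ?f = "\<lambda>z. ennreal (exp (-(euler B c x0 (Suc k) z)\<^sup>2 / (2 * v')))"
  have [measurable]: "euler B c x0 (Suc k) \<in> borel_measurable (PiM {..<Suc k} (\<lambda>_. gauss h))"
    by (rule euler_measurable) (auto simp: B)
  have [measurable]: "euler B c x0 k \<in> borel_measurable (PiM {..<k} (\<lambda>_. gauss h))"
    by (rule euler_measurable) (auto simp: B)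
  have ins: "{..<Suc k} = insert k {..<k}" by auto
  have "(\<integral>\<^sup>+z. ?f z \<partial>PiM {..<Suc k} (\<lambda>_. gauss h))
      = (\<integral>\<^sup>+z. \<integral>\<^sup>+y. ?f (z(k := y)) \<partial>gauss h \<partial>PiM {..<k} (\<lambda>_. gauss h))"
    unfolding ins by (rule P.product_nn_integral_insert) (auto simp flip: ins simp del: euler.simps)
  also have "\<dots> = (\<integral>\<^sup>+z. ennreal (sqrt (v' / (v' + c\<^sup>2 * h)) *
      exp (- (euler B c x0 k z + B k (euler B c x0 k z))\<^sup>2 / (2 * (v' + c\<^sup>2 * h)))) \<partial>PiM {..<k} (\<lambda>_. gauss h))"
  proof (rule nn_integral_cong)
    fix z :: "nat \<Rightarrow> real"
    have *: "euler B c x0 k (z(k := y)) = euler B c x0 k z" for y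
      by (rule euler_cong) auto
    show "(\<integral>\<^sup>+y. ?f (z(k := y)) \<partial>gauss h) = ennreal (sqrt (v' / (v' + c\<^sup>2 * h)) *
      exp (- (euler B c x0 k z + B k (euler B c x0 k z))\<^sup>2 / (2 * (v' + c\<^sup>2 * h))))"
      unfolding euler.simps * fun_upd_same by (rule nn_integral_gaussian_shift[OF c v(2) h])
  qed
  also have "\<dots> \<le> (\<integral>\<^sup>+z. ennreal (sqrt (v' / (v' + c\<^sup>2 * h))) *
      ennreal (exp (-(euler B c x0 k z)\<^sup>2 / (2 * v))) \<partial>PiM {..<k} (\<lambda>_. gauss h))"
  proof (rule nn_integral_mono)
    fix z
    let ?y = "euler B c x0 k z"
    have pos: "0 < v' + c\<^sup>2 * h" using c h v by (simp add: add_pos_pos)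
    have "r \<noteq> 0" using r pos by auto
    have "?y\<^sup>2 / (2 * v) = (r * ?y)\<^sup>2 / (2 * (v' + c\<^sup>2 * h))"
      using \<open>r \<noteq> 0\<close> by (simp add: r[symmetric] power_mult_distrib)
    also have "\<dots> \<le> (?y + B k ?y)\<^sup>2 / (2 * (v' + c\<^sup>2 * h))"
      using pos exp by (intro divide_right_mono) auto
    finally have "exp (- (?y + B k ?y)\<^sup>2 / (2 * (v' + c\<^sup>2 * h))) \<le> exp (- ?y\<^sup>2 / (2 * v))"
      by simp
    then show "ennreal (sqrt (v' / (v' + c\<^sup>2 * h)) * exp (- (?y + B k ?y)\<^sup>2 / (2 * (v' + c\<^sup>2 * h))))
      \<le> ennreal (sqrt (v' / (v' + c\<^sup>2 * h))) * ennreal (exp (- ?y\<^sup>2 / (2 * v)))"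
      using pos v by (subst ennreal_mult[symmetric]) (auto intro!: ennreal_leI mult_left_mono)
  qed
  also have "\<dots> = ennreal (sqrt (v' / (v' + c\<^sup>2 * h))) *
       (\<integral>\<^sup>+z. ennreal (exp (-(euler B c x0 k z)\<^sup>2 / (2 * v))) \<partial>PiM {..<k} (\<lambda>_. gauss h))"
    by (rule nn_integral_cmult) measurable
  finally show ?thesis .
qed

text \<open>With \<open>v\<close> solving the backward variance recursion \<open>v k * (r k)\<^sup>2 = v (k + 1) + c\<^sup>2 * h\<close>
  and \<open>u k = v k / (R k)\<^sup>2\<close>, the process \<open>exp (- y\<^sup>2 / (2 * v k)) / sqrt (u k)\<close> is a supermartingale
  along the scheme; Markov's inequality at time \<open>n\<close> then gives the bound.\<close>

lemma euler_small_ball: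
  fixes B :: "nat \<Rightarrow> real \<Rightarrow> real" and r :: "nat \<Rightarrow> real"
  defines "R \<equiv> \<lambda>k. \<Prod>i<k. r i"
  assumes c: "0 < c" and h: "0 < h" and V: "0 < V" and r: "\<And>k. k < n \<Longrightarrow> 0 < r k"
    and exp: "\<And>k y. k < n \<Longrightarrow> (r k * y)\<^sup>2 \<le> (y + B k y)\<^sup>2"
    and B: "\<And>k. B k \<in> borel_measurable borel" and n: "0 < n"
  shows "emeasure (PiM {..<n} (\<lambda>_. gauss h)) {z \<in> space (PiM {..<n} (\<lambda>_. gauss h)). (euler B c x0 n z)\<^sup>2 \<le> V}
    \<le> ennreal (exp (1/2) * sqrt V / (R n * sqrt (c\<^sup>2 * h * (\<Sum>j<n. 1 / (R (Suc j))\<^sup>2))))"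
proof -
  \<comment> \<open>Dividing the variance recursion by the squared growth factors makes it a plain
    sum. The term \<open>V / (R n)\<^sup>2\<close> imposes the terminal condition
    \<open>v n = V\<close>.\<close>
  define u where "u k = V / (R n)\<^sup>2 + c\<^sup>2 * h * (\<Sum>j=k..<n. 1 / (R (Suc j))\<^sup>2)" for k
  define v where "v k = (R k)\<^sup>2 * u k" for k
  have R: "R k > 0" if "k \<le> n" for k unfolding R_def using r that by (intro prod_pos) auto
  have u: "u k > 0" for k unfolding u_def using V R[of n] c h
    by (intro add_pos_nonneg mult_nonneg_nonneg sum_nonneg divide_pos_pos zero_less_power) auto
  have v: "v k > 0" if "k \<le> n" for k unfolding v_def using u R that by (intro mult_pos_pos zero_less_power)
  have RS: "R (Suc k) = R k * r k" for k unfolding R_def by simp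
  have uS: "u k = u (Suc k) + c\<^sup>2 * h / (R (Suc k))\<^sup>2" if "k < n" for k
    unfolding u_def using that by (simp add: sum.atLeast_Suc_lessThan ring_distribs)
  have vS: "v (Suc k) + c\<^sup>2 * h = (R (Suc k))\<^sup>2 * u k" if "k < n" for k
    unfolding v_def uS[OF that] using R[of "Suc k"] that by (simp add: field_simps)
  let ?I = "\<lambda>k. \<integral>\<^sup>+z. ennreal (exp (-(euler B c x0 k z)\<^sup>2 / (2 * v k))) \<partial>PiM {..<k} (\<lambda>_. gauss h)"
  interpret G: prob_space "gauss h"
    using h by (intro prob_space_normal_density) simp
  have I: "?I k \<le> ennreal (sqrt (u k / u 0))" if "k \<le> n" for k
    using that
  proof (induction k)
    case 0
    interpret P: prob_space "PiM {..<0} (\<lambda>_::nat. gauss h)"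
      by (rule prob_space_PiM) unfold_locales
    \<comment> \<open>The Gaussian at the starting point is estimated by 1, which makes the bound
      uniform in \<open>x0\<close>.\<close>
    show ?case using u[of 0] v[of 0]
      by (simp add: P.emeasure_space_1 del: lessThan_0)
  next
    case (Suc k)
    then have k: "k < n" by simp
    have "?I (Suc k) \<le> ennreal (sqrt (v (Suc k) / (v (Suc k) + c\<^sup>2 * h))) * ?I k"
      by (rule euler_gaussian_step[OF c h v v, where r = "r k"])
        (use k exp B vS[OF k] in \<open>auto simp: v_def RS power_mult_distrib\<close>)
    also have "\<dots> \<le> ennreal (sqrt (v (Suc k) / (v (Suc k) + c\<^sup>2 * h))) * ennreal (sqrt (u k / u 0))"
      using Suc by (intro mult_left_mono) auto
    also have "\<dots> = ennreal (sqrt (v (Suc k) / (v (Suc k) + c\<^sup>2 * h)) * sqrt (u k / u 0))"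
      by (rule ennreal_mult''[symmetric]) (use u[of k] u[of 0] in simp)
    also have "sqrt (v (Suc k) / (v (Suc k) + c\<^sup>2 * h)) * sqrt (u k / u 0)
       = sqrt (v (Suc k) / (v (Suc k) + c\<^sup>2 * h) * (u k / u 0))"
      by (simp only: real_sqrt_mult)
    \<comment> \<open>In terms of \<open>u\<close> the step factor is
      \<open>u (Suc k) / u k\<close>, so the factors telescope.\<close>
    also have "v (Suc k) / (v (Suc k) + c\<^sup>2 * h) * (u k / u 0) = u (Suc k) / u 0"
      unfolding vS[OF k] unfolding v_def using R[of "Suc k"] u[of k] k by (simp add: field_simps)
    finally show ?case .
  qed
  have vn: "v n = V" unfolding v_def u_def using R[of n] by simp
  let ?P = "PiM {..<n} (\<lambda>_. gauss h)"
  have [measurable]: "euler B c x0 n \<in> borel_measurable ?P"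
    by (rule euler_measurable) (auto simp: B)
  have "emeasure ?P {z \<in> space ?P. (euler B c x0 n z)\<^sup>2 \<le> V}
      = (\<integral>\<^sup>+z. indicator {z \<in> space ?P. (euler B c x0 n z)\<^sup>2 \<le> V} z \<partial>?P)"
    by (rule nn_integral_indicator[symmetric]) measurable
  also have "\<dots> \<le> (\<integral>\<^sup>+z. ennreal (exp (1/2)) * ennreal (exp (-(euler B c x0 n z)\<^sup>2 / (2 * V))) \<partial>?P)"
  proof (rule nn_integral_mono)
    fix z
    \<comment> \<open>On the ball the Gaussian of variance \<open>V\<close> is at least
      \<open>exp (-1/2)\<close>; this is the source of the constant
      \<open>exp (1/2)\<close>.\<close>
    have "1 \<le> exp (1/2) * exp (-y / (2 * V))" if "y \<le> V" for y
      using that V by (simp add: exp_add[symmetric] field_simps)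
    then show "indicator {z \<in> space ?P. (euler B c x0 n z)\<^sup>2 \<le> V} z \<le>
        ennreal (exp (1/2)) * ennreal (exp (-(euler B c x0 n z)\<^sup>2 / (2 * V)))"
      by (auto split: split_indicator simp: ennreal_mult''[symmetric])
  qed
  also have "\<dots> = ennreal (exp (1/2)) * ?I n"
    unfolding vn by (rule nn_integral_cmult) measurable
  also have "\<dots> \<le> ennreal (exp (1/2)) * ennreal (sqrt (u n / u 0))"
    by (intro mult_left_mono I) auto
  also have "\<dots> = ennreal (exp (1/2) * sqrt (u n / u 0))"
    by (rule ennreal_mult''[symmetric]) (use u[of n] u[of 0] in simp)
  also have "\<dots> \<le> ennreal (exp (1/2) * sqrt V / (R n * sqrt (c\<^sup>2 * h * (\<Sum>j<n. 1 / (R (Suc j))\<^sup>2))))"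
  proof (rule ennreal_leI)
    let ?S = "c\<^sup>2 * h * (\<Sum>j<n. 1 / (R (Suc j))\<^sup>2)"
    have S: "?S > 0" using c h n R
      by (intro mult_pos_pos sum_pos divide_pos_pos zero_less_power) auto
    \<comment> \<open>Only the contribution of the noise to \<open>u 0\<close> is kept. It is
      positive because there is at least one step.\<close>
    have "?S \<le> u 0" unfolding u_def[of 0] atLeast0LessThan using V by simp
    then have "u n / u 0 \<le> u n / ?S"
      using S u[of n] by (intro divide_left_mono mult_pos_pos[OF u S]) auto
    then have "sqrt (u n / u 0) \<le> sqrt (V / (R n)\<^sup>2 / ?S)"
      unfolding u_def[of n] by simp
    also have "\<dots> = sqrt V / (R n * sqrt ?S)"
      using R[of n] by (simp add: real_sqrt_divide real_sqrt_mult)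
    finally show "exp (1/2) * sqrt (u n / u 0) \<le> exp (1/2) * sqrt V / (R n * sqrt ?S)"
      by (simp only: times_divide_eq_right[symmetric] mult_left_mono exp_ge_zero)
  qed
  finally show ?thesis .
qed

section \<open>Discrete counterparts of exponential identities\<close>

text \<open>A discrete form of integrating \<open>2 * a * exp (-2 * A)\<close> with
  \<open>A' = a\<close>. The differences of the inverse squared products telescope, and each has
  numerator \<open>(1 + p)\<^sup>2 - 1\<close>, at most \<open>3 * p\<close> for \<open>p\<close> in
  \<open>[0, 1]\<close>. Using 3 where the continuous case has 2 costs only a constant.\<close>

lemma sum_inverse_prod_lower:
  fixes p :: "nat \<Rightarrow> real"
  assumes "\<And>i. i < n \<Longrightarrow> 0 \<le> p i" "\<And>i. i < n \<Longrightarrow> p i \<le> 1"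
  shows "(1 - 1 / (\<Prod>i<n. 1 + p i)\<^sup>2) / 3 \<le> (\<Sum>j<n. p j / (\<Prod>i<Suc j. 1 + p i)\<^sup>2)"
  using assms
proof (induction n)
  case (Suc n)
  let ?R = "\<lambda>k. \<Prod>i<k. 1 + p i"
  have R: "?R n > 0" using Suc.prems(1) by (intro prod_pos) (auto intro: add_pos_nonneg)
  have RS: "?R (Suc n) = ?R n * (1 + p n)" by simp
  have p1: "1 + p n > 0" using Suc.prems(1)[of n] by simp
  have "1 / (?R n)\<^sup>2 - 1 / (?R (Suc n))\<^sup>2 = ((1 + p n)\<^sup>2 - 1) / (?R (Suc n))\<^sup>2"
  proof -
    have "1 / a\<^sup>2 - 1 / (a * b)\<^sup>2 = (b\<^sup>2 - 1) / (a * b)\<^sup>2" if "a > 0" "b > 0" for a b :: real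
      using that by (simp add: field_simps)
    then show ?thesis unfolding RS using R p1 by blast
  qed
  also have "\<dots> \<le> (3 * p n) / (?R (Suc n))\<^sup>2"
  proof (rule divide_right_mono)
    have "p n * p n \<le> p n * 1" using Suc.prems by (intro mult_left_mono) auto
    then show "(1 + p n)\<^sup>2 - 1 \<le> 3 * p n" by (simp add: power2_eq_square algebra_simps)
  qed simp
  finally have "1 / (?R n)\<^sup>2 - 1 / (?R (Suc n))\<^sup>2 \<le> 3 * (p n / (?R (Suc n))\<^sup>2)" by simp
  moreover have "(1 - 1 / (?R n)\<^sup>2) / 3 \<le> (\<Sum>j<n. p j / (?R (Suc j))\<^sup>2)"
    using Suc by simp
  moreover have "(1 - B) / 3 \<le> S + q" if "A - B \<le> 3 * q" "(1 - A) / 3 \<le> S" for A B S q :: real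
    using that by argo
  ultimately show ?case unfolding sum.lessThan_Suc by blast
qed simp

text \<open>Follows from \<open>ln (1 + p) \<ge> p - p\<^sup>2 \<ge> (1 - \<delta>) * p\<close>. On
  a fine grid \<open>\<delta>\<close> is of the order of the mesh, so the exact exponent is
  recovered in the limit.\<close>

lemma prod_one_plus_ge_exp:
  fixes p :: "nat \<Rightarrow> real"
  assumes "\<And>i. i < n \<Longrightarrow> 0 \<le> p i" "\<And>i. i < n \<Longrightarrow> p i \<le> \<delta>" "\<delta> \<le> 1"
  shows "exp ((1 - \<delta>) * (\<Sum>i<n. p i)) \<le> (\<Prod>i<n. 1 + p i)"
proof -
  have "exp ((1 - \<delta>) * p i) \<le> 1 + p i" if "i < n" for i
  proof -
    have p: "0 \<le> p i" "p i \<le> \<delta>" using assms that by auto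
    have "exp ((1 - \<delta>) * p i) \<le> exp (p i - (p i)\<^sup>2)"
      using mult_right_mono[OF p(2,1)] by (simp add: power2_eq_square algebra_simps)
    also have "\<dots> \<le> exp (ln (1 + p i))"
      using ln_one_plus_pos_lower_bound[of "p i"] p assms(3) by (simp only: exp_le_cancel_iff)
    also have "\<dots> = 1 + p i" using p by simp
    finally show ?thesis .
  qed
  then show ?thesis
    unfolding sum_distrib_left by (subst exp_sum) (auto intro!: prod_mono)
qed

section \<open>The truncated drift\<close>

text \<open>For \<open>0 \<le> d\<close> this is the projection onto the interval from
  \<open>-d\<close> to \<open>d\<close>: it is 1-Lipschitz and never has the sign opposite to
  \<open>y\<close>.\<close>

definition clamp_abs :: "real \<Rightarrow> real \<Rightarrow> real" where
  "clamp_abs d y = max (- d) (min d y)"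

text \<open>The drift accumulated over a step of length \<open>h\<close> with \<open>a = \<integral>\<mu>\<close>: exact for \<open>\<bar>y\<bar> \<le> d\<close>, and modified
  outside so as to be globally Lipschitz while still repelling from \<open>0\<close> at rate at least
  \<open>\<rho> * a\<close> everywhere.\<close>

definition trunc_drift :: "real \<Rightarrow> real \<Rightarrow> real \<Rightarrow> real \<Rightarrow> real \<Rightarrow> real" where
  "trunc_drift \<rho> a h d y =
     \<rho> * a * y + clamp_abs d y * ((1 - \<rho>) * a - h * (clamp_abs d y)\<^sup>2)"

lemma clamp_abs_sq_le: "0 \<le> d \<Longrightarrow> (clamp_abs d y)\<^sup>2 \<le> d\<^sup>2"
  unfolding clamp_abs_def by (intro power2_le_iff_abs_le[THEN iffD2]) auto

lemma trunc_drift_inside: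
  "\<bar>y\<bar> \<le> d \<Longrightarrow> trunc_drift \<rho> a h d y = a * y - h * y ^ 3"
proof -
  assume "\<bar>y\<bar> \<le> d"
  then have "clamp_abs d y = y" by (auto simp: clamp_abs_def)
  then show ?thesis by (simp add: trunc_drift_def algebra_simps power2_eq_square power3_eq_cube)
qed

lemma trunc_drift_measurable: "trunc_drift \<rho> a h d \<in> borel_measurable borel"
proof -
  have "(\<lambda>y. \<rho> * a * y + max (-d) (min d y) * ((1 - \<rho>) * a - h * (max (-d) (min d y))\<^sup>2))
      \<in> borel_measurable borel" by measurable
  then show ?thesis
    by (simp add: trunc_drift_def[abs_def] clamp_abs_def)
qed

text \<open>The drift step is the linear one plus a term \<open>\<psi>\<close>, which the bound on
  \<open>h * d\<^sup>2\<close> prevents from having the sign opposite to \<open>y\<close>. Adding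
  such a term cannot bring the point closer to 0.\<close>

lemma trunc_drift_expanding:
  assumes "0 \<le> \<rho>" "0 \<le> a" "0 \<le> h" "0 \<le> d" "h * d\<^sup>2 \<le> (1 - \<rho>) * a" "0 < e"
  shows "((1 + \<rho> * a / e) * y)\<^sup>2 \<le> (y + trunc_drift \<rho> a h d y / e)\<^sup>2"
proof -
  define \<psi> where "\<psi> = clamp_abs d y * ((1 - \<rho>) * a - h * (clamp_abs d y)\<^sup>2) / e"
  have "h * (clamp_abs d y)\<^sup>2 \<le> h * d\<^sup>2"
    using assms by (intro mult_left_mono clamp_abs_sq_le)
  then have nn: "0 \<le> (1 - \<rho>) * a - h * (clamp_abs d y)\<^sup>2" using assms by simp
  have "0 \<le> y * clamp_abs d y"
    using assms(4) by (auto simp: clamp_abs_def max_def min_def zero_le_mult_iff)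
  then have y\<psi>: "0 \<le> y * \<psi>"
    using mult_nonneg_nonneg[OF _ nn] assms(6) unfolding \<psi>_def
    by (metis (no_types, opaque_lifting) divide_nonneg_pos mult.assoc times_divide_eq_right)
  have "y + trunc_drift \<rho> a h d y / e = (1 + \<rho> * a / e) * y + \<psi>"
    unfolding trunc_drift_def \<psi>_def using assms(6) by (simp add: field_simps)
  moreover have "((1 + \<rho> * a / e) * y + \<psi>)\<^sup>2
      = ((1 + \<rho> * a / e) * y)\<^sup>2 + 2 * (1 + \<rho> * a / e) * (y * \<psi>) + \<psi>\<^sup>2"
    by (simp add: power2_eq_square algebra_simps)
  moreover have "0 \<le> 2 * (1 + \<rho> * a / e) * (y * \<psi>)"
    using mult_nonneg_nonneg[OF _ y\<psi>, of "2 * (1 + \<rho> * a / e)"] assms by simp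
  ultimately show ?thesis by simp
qed

lemma cube_diff_bound:
  fixes x y :: real
  assumes "x\<^sup>2 \<le> m" "y\<^sup>2 \<le> m"
  shows "\<bar>x ^ 3 - y ^ 3\<bar> \<le> 3 * m * \<bar>x - y\<bar>"
proof -
  have "x ^ 3 - y ^ 3 = (x\<^sup>2 + x * y + y\<^sup>2) * (x - y)"
    by (simp add: power2_eq_square power3_eq_cube algebra_simps)
  moreover have "\<bar>x\<^sup>2 + x * y + y\<^sup>2\<bar> \<le> 3 * m"
    using assms sum_squares_bound[of x y] sum_squares_bound[of x "- y"]
      zero_le_power2[of x] zero_le_power2[of y] by (simp add: abs_if)
  ultimately show ?thesis by (simp add: abs_mult mult_right_mono)
qed

text \<open>The linear part contributes \<open>\<rho> * a\<close>, the clamped linear part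
  \<open>(1 - \<rho>) * a\<close>, and the clamped cubic part \<open>3 * h * d\<^sup>2\<close>,
  which is at most \<open>3 * (1 - \<rho>) * a\<close>. The sum is at most
  \<open>4 * a\<close>.\<close>

lemma trunc_drift_lipschitz:
  assumes "0 \<le> \<rho>" "\<rho> \<le> 1" "0 \<le> a" "0 \<le> h" "0 \<le> d" "h * d\<^sup>2 \<le> (1 - \<rho>) * a"
  shows "\<bar>trunc_drift \<rho> a h d x - trunc_drift \<rho> a h d y\<bar> \<le> 4 * a * \<bar>x - y\<bar>"
proof -
  let ?u = "clamp_abs d x" and ?v = "clamp_abs d y"
  have uv: "\<bar>?u - ?v\<bar> \<le> \<bar>x - y\<bar>" using assms(5) by (auto simp: clamp_abs_def)
  have "trunc_drift \<rho> a h d x - trunc_drift \<rho> a h d y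
      = \<rho> * a * (x - y) + (1 - \<rho>) * a * (?u - ?v) - h * (?u ^ 3 - ?v ^ 3)"
    by (simp add: trunc_drift_def algebra_simps power2_eq_square power3_eq_cube)
  also have "\<bar>\<dots>\<bar> \<le> \<bar>\<rho> * a * (x - y)\<bar> + \<bar>(1 - \<rho>) * a * (?u - ?v)\<bar> + \<bar>h * (?u ^ 3 - ?v ^ 3)\<bar>"
    by linarith
  also have "\<bar>\<rho> * a * (x - y)\<bar> = \<rho> * a * \<bar>x - y\<bar>" using assms by (simp add: abs_mult)
  also have "\<bar>(1 - \<rho>) * a * (?u - ?v)\<bar> \<le> (1 - \<rho>) * a * \<bar>x - y\<bar>"
    using assms uv by (simp add: abs_mult mult_left_mono)
  also have "\<bar>h * (?u ^ 3 - ?v ^ 3)\<bar> \<le> h * (3 * d\<^sup>2 * \<bar>x - y\<bar>)"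
  proof -
    have "\<bar>?u ^ 3 - ?v ^ 3\<bar> \<le> 3 * d\<^sup>2 * \<bar>?u - ?v\<bar>"
      by (intro cube_diff_bound clamp_abs_sq_le assms)
    also have "\<dots> \<le> 3 * d\<^sup>2 * \<bar>x - y\<bar>" using uv by (intro mult_left_mono) auto
    finally show ?thesis using assms by (simp add: abs_mult mult_left_mono)
  qed
  also have "h * (3 * d\<^sup>2 * \<bar>x - y\<bar>) \<le> 3 * ((1 - \<rho>) * a) * \<bar>x - y\<bar>"
    using mult_right_mono[OF assms(6), of "3 * \<bar>x - y\<bar>"] by (simp add: algebra_simps)
  also have "\<rho> * a * \<bar>x - y\<bar> + (1 - \<rho>) * a * \<bar>x - y\<bar> + 3 * ((1 - \<rho>) * a) * \<bar>x - y\<bar>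
      \<le> 4 * a * \<bar>x - y\<bar>"
    using assms by (simp add: algebra_simps)
  finally show ?thesis by simp
qed

section \<open>Pathwise convergence of the Euler scheme on a uniform grid\<close>

lemma discrete_gronwall:
  fixes e :: "nat \<Rightarrow> real"
  assumes "e 0 \<le> 0" "\<And>k. k < n \<Longrightarrow> e (Suc k) \<le> (1 + \<Lambda>) * e k + \<eta>" "0 \<le> \<Lambda>" "0 \<le> \<eta>"
  shows "e n \<le> real n * \<eta> * exp (real n * \<Lambda>)"
proof -
  have "e k \<le> real k * \<eta> * (1 + \<Lambda>) ^ k" if "k \<le> n" for k
    using that
  proof (induction k)
    case (Suc k)
    have "e (Suc k) \<le> (1 + \<Lambda>) * e k + \<eta>" using Suc assms by simp
    also have "\<dots> \<le> (1 + \<Lambda>) * (real k * \<eta> * (1 + \<Lambda>) ^ k) + \<eta> * (1 + \<Lambda>) ^ Suc k"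
    proof (intro add_mono mult_left_mono)
      show "e k \<le> real k * \<eta> * (1 + \<Lambda>) ^ k" using Suc by simp
      have "1 \<le> (1 + \<Lambda>) ^ Suc k" using assms(3) by (intro one_le_power) simp
      then show "\<eta> \<le> \<eta> * (1 + \<Lambda>) ^ Suc k" using mult_left_mono[OF _ assms(4)] by fastforce
    qed (use assms in simp)
    finally show ?case by (simp add: algebra_simps)
  qed (use assms in simp)
  then have "e n \<le> real n * \<eta> * (1 + \<Lambda>) ^ n" by simp
  also have "\<dots> \<le> real n * \<eta> * exp \<Lambda> ^ n"
    using assms by (intro mult_left_mono power_mono) auto
  finally show ?thesis by (simp add: exp_of_nat_mult)
qed

lemma mono_on_mult_continuous_integrable:
  fixes \<mu> f :: "real \<Rightarrow> real"
  assumes "mono_on {a..b} \<mu>" "continuous_on {a..b} f"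
  shows "(\<lambda>u. \<mu> u * f u) integrable_on {a..b}"
proof -
  have "f \<in> borel_measurable (lebesgue_on {a..b})"
    using assms(2) by (intro continuous_imp_measurable_on_sets_lebesgue) auto
  moreover have "bounded (f ` {a..b})"
    using assms(2) by (intro compact_imp_bounded compact_continuous_image) auto
  moreover have "\<mu> absolutely_integrable_on {a..b}"
    using integrable_mono_on[OF assms(1)] by (simp add: integrable_restrict_space set_integrable_def)
  ultimately have "(\<lambda>u. f u * \<mu> u) absolutely_integrable_on {a..b}"
    by (intro absolutely_integrable_bounded_measurable_product_real) auto
  then show ?thesis by (simp add: mult.commute set_lebesgue_integral_eq_integral(1))
qed

definition grid :: "real \<Rightarrow> real \<Rightarrow> nat \<Rightarrow> nat \<Rightarrow> real" where
  "grid s t n k = s + real k * ((t - s) / real n)"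

text \<open>The coefficient is the exact integral of \<open>\<mu>\<close> over the cell, so that the
  cells add up to the integral over \<open>{s..t}\<close> without discretisation error. The cutoff
  is the half-width of the strip at the left grid point; for increasing \<open>\<mu>\<close> this
  gives the condition \<open>h * d\<^sup>2 \<le> (1 - \<rho>) * a\<close>.\<close>

definition grid_drift :: "(real \<Rightarrow> real) \<Rightarrow> real \<Rightarrow> real \<Rightarrow> real \<Rightarrow> real \<Rightarrow> nat \<Rightarrow> nat \<Rightarrow> real \<Rightarrow> real" where
  "grid_drift \<mu> \<rho> e s t n k y =
     trunc_drift \<rho> (integral {grid s t n k..grid s t n (Suc k)} \<mu>) ((t - s) / real n)
       (sqrt ((1 - \<rho>) * \<mu> (grid s t n k))) y / e"

lemma grid_Suc: "grid s t n (Suc k) = grid s t n k + (t - s) / real n"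
proof -
  have "s + (1 + a) * b = s + a * b + b" for a b :: real by (simp add: distrib_right)
  then show ?thesis unfolding grid_def of_nat_Suc .
qed

lemma grid_0: "grid s t n 0 = s" and grid_n: "0 < n \<Longrightarrow> grid s t n n = t"
  by (auto simp: grid_def)

lemma grid_mem:
  assumes "s \<le> t" "k \<le> n" "0 < n"
  shows "grid s t n k \<in> {s..t}"
proof -
  have "real k * ((t - s) / real n) \<le> real n * ((t - s) / real n)"
    using assms by (intro mult_right_mono) auto
  then show ?thesis using assms by (auto simp: grid_def)
qed

lemma grid_integral_bounds:
  assumes "s < t" "k < n" and mono: "mono_on {s..t} \<mu>"
  defines "I \<equiv> {grid s t n k..grid s t n (Suc k)}" and "h \<equiv> (t - s) / real n"
  shows "\<mu> integrable_on I" "I \<subseteq> {s..t}" "h * \<mu> (grid s t n k) \<le> integral I \<mu>" "integral I \<mu> \<le> h * \<mu> t"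
proof -
  have h: "h > 0" using assms unfolding h_def by simp
  show I: "I \<subseteq> {s..t}" unfolding I_def using grid_mem[of s t k n] grid_mem[of s t "Suc k" n] assms by auto
  show int: "\<mu> integrable_on I"
    using integrable_on_mono_on[OF mono_on_subset[OF mono I[unfolded I_def]]] unfolding I_def .
  have Ih: "I = {grid s t n k..grid s t n k + h}" by (simp add: I_def h_def grid_Suc)
  have "\<mu> (grid s t n k) \<le> \<mu> u \<and> \<mu> u \<le> \<mu> t" if "u \<in> I" for u
  proof -
    have "grid s t n k \<in> I" "grid s t n k \<le> u" using that h unfolding Ih by auto
    then show ?thesis using that I by (intro conjI mono_onD[OF mono]) auto
  qed
  moreover have "((\<lambda>u. m) has_integral (h * m)) I" for m :: real
    unfolding Ih using has_integral_const_real[of m "grid s t n k" "grid s t n k + h"] h by simp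
  ultimately show "h * \<mu> (grid s t n k) \<le> integral I \<mu>" "integral I \<mu> \<le> h * \<mu> t"
    using int by (auto intro: has_integral_le[OF _ integrable_integral] has_integral_le[OF integrable_integral])
qed

text \<open>At the left grid point the path lies within the cutoff, so the scheme uses the true
  drift with only the position frozen. Within the cell the position moves by at most
  \<open>\<kappa>\<close>, which changes the linear term by at most
  \<open>\<mu> t * \<kappa>\<close> and the cubic term by at most
  \<open>3 * \<mu> t * \<kappa>\<close>.\<close>

lemma grid_drift_local_error:
  fixes x :: "real \<Rightarrow> real"
  assumes st: "s < t" and k: "k < n" and mono: "mono_on {s..t} \<mu>" and pos: "0 < \<mu> s"
    and \<rho>: "0 \<le> \<rho>" "\<rho> \<le> 1" and e: "0 < e"
    and x: "continuous_on {s..t} x" and inside: "\<And>u. u \<in> {s..t} \<Longrightarrow> (x u)\<^sup>2 \<le> (1 - \<rho>) * \<mu> u"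
    and osc: "\<And>u v. u \<in> {s..t} \<Longrightarrow> v \<in> {s..t} \<Longrightarrow> \<bar>u - v\<bar> \<le> (t - s) / real n \<Longrightarrow> \<bar>x u - x v\<bar> \<le> \<kappa>"
  shows "\<bar>integral {grid s t n k..grid s t n (Suc k)} (\<lambda>u. (\<mu> u * x u - (x u) ^ 3) / e)
          - grid_drift \<mu> \<rho> e s t n k (x (grid s t n k))\<bar> \<le> 4 * \<mu> t * \<kappa> / e * ((t - s) / real n)"
proof -
  define g where "g = grid s t n k"
  define h where "h = (t - s) / real n"
  define I where "I = {g..g + h}"
  have I: "{grid s t n k..grid s t n (Suc k)} = I" unfolding I_def g_def h_def grid_Suc ..
  note gi = grid_integral_bounds[OF st k mono, unfolded I]
  have h: "0 < h" using st k unfolding h_def by simp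
  then have g: "g \<in> I" unfolding I_def by simp
  have gst: "g \<in> {s..t}" using g gi(2) by auto
  have \<kappa>: "0 \<le> \<kappa>" using osc[of s s] st by simp
  have M: "0 < \<mu> u \<and> \<mu> u \<le> \<mu> t" if "u \<in> {s..t}" for u
    using mono_onD[OF mono, of s u] mono_onD[OF mono, of u t] that pos by auto
  have xM: "(x u)\<^sup>2 \<le> \<mu> t" if "u \<in> {s..t}" for u
  proof -
    have "(x u)\<^sup>2 \<le> 1 * \<mu> u"
      using inside[OF that] M[OF that] \<rho> mult_right_mono[of "1 - \<rho>" 1 "\<mu> u"] by linarith
    then show ?thesis using M[OF that] by simp
  qed
  have monoI: "mono_on I \<mu>" and xI: "continuous_on I x"
    using mono_on_subset[OF mono gi(2)] continuous_on_subset[OF x gi(2)] .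
  have int1: "(\<lambda>u. \<mu> u * x u) integrable_on I"
    unfolding I_def using monoI xI by (intro mono_on_mult_continuous_integrable) (auto simp: I_def)
  have int2: "(\<lambda>u. (x u) ^ 3) integrable_on I"
    unfolding I_def using xI by (intro integrable_continuous_real continuous_intros) (auto simp: I_def)
  have D: "grid_drift \<mu> \<rho> e s t n k (x g) = (integral I \<mu> * x g - h * (x g) ^ 3) / e"
  proof -
    have "\<bar>x g\<bar> \<le> sqrt ((1 - \<rho>) * \<mu> g)"
      using inside[OF gst] by (metis real_sqrt_abs real_sqrt_le_iff)
    then show ?thesis unfolding grid_drift_def I unfolding g_def[symmetric] h_def[symmetric]
      by (subst trunc_drift_inside) auto
  qed
  let ?f = "\<lambda>u. (\<mu> u * x u - (x u) ^ 3) / e"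
  have f: "(?f has_integral integral I ?f) I"
    using int1 int2 by (intro integrable_integral integrable_on_divide integrable_diff)
  have c: "((\<lambda>u. (x g) ^ 3) has_integral (h * (x g) ^ 3)) I"
    unfolding I_def using has_integral_const_real[of "(x g) ^ 3" g "g + h"] h by simp
  have d: "((\<lambda>u. (\<mu> u * x g - (x g) ^ 3) / e) has_integral
      (integral I \<mu> * x g - h * (x g) ^ 3) / e) I"
    by (intro has_integral_divide has_integral_diff has_integral_mult_left integrable_integral gi(1) c)
  have "((\<lambda>u. ?f u - (\<mu> u * x g - (x g) ^ 3) / e) has_integral
      (integral I ?f - (integral I \<mu> * x g - h * (x g) ^ 3) / e)) {g..g + h}"
    using has_integral_diff[OF f d] unfolding I_def .
  then have "norm (integral I ?f - (integral I \<mu> * x g - h * (x g) ^ 3) / e)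
      \<le> 4 * \<mu> t * \<kappa> / e * measure lborel {g..g + h}"
  proof (rule has_integral_bound_real[where S = "{}", rotated 2])
    show "0 \<le> 4 * \<mu> t * \<kappa> / e" using M[OF gst] \<kappa> e by simp
    fix u assume "u \<in> {g..g + h} - {}"
    then have u: "u \<in> {g..g + h}" by simp
    then have ust: "u \<in> {s..t}" using gi(2) I_def by auto
    have "\<bar>u - g\<bar> \<le> (t - s) / real n" using u unfolding h_def by auto
    then have o: "\<bar>x u - x g\<bar> \<le> \<kappa>" using osc ust gst by blast
    have "?f u - (\<mu> u * x g - (x g) ^ 3) / e = (\<mu> u * (x u - x g) - ((x u) ^ 3 - (x g) ^ 3)) / e"
      unfolding diff_divide_distrib[symmetric] by (simp add: algebra_simps)
    moreover have "\<bar>\<mu> u * (x u - x g) - ((x u) ^ 3 - (x g) ^ 3)\<bar> \<le> 4 * \<mu> t * \<kappa>"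
    proof -
      have "\<bar>\<mu> u * (x u - x g)\<bar> \<le> \<mu> t * \<kappa>"
        using M[OF ust] o by (auto simp: abs_mult intro!: mult_mono)
      moreover have "\<bar>(x u) ^ 3 - (x g) ^ 3\<bar> \<le> 3 * \<mu> t * \<kappa>"
        using cube_diff_bound[OF xM[OF ust] xM[OF gst]] o M[OF ust]
        by (rule_tac order_trans[OF _ mult_left_mono]) auto
      ultimately show ?thesis by linarith
    qed
    ultimately show "norm (?f u - (\<mu> u * x g - (x g) ^ 3) / e) \<le> 4 * \<mu> t * \<kappa> / e"
      by (simp only: real_norm_def abs_divide abs_of_pos[OF e] divide_right_mono less_imp_le[OF e])
  qed simp
  then show ?thesis unfolding I unfolding g_def[symmetric] h_def[symmetric] D using h by simp
qed

text \<open>The noise is additive and enters path and scheme identically, so it cancels from the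
  error. What remains is a deterministic recursion with a Lipschitz drift and local errors
  controlled by the uniform continuity of \<open>x\<close>.\<close>

lemma euler_grid_convergence:
  fixes x w :: "real \<Rightarrow> real"
  assumes st: "s < t" and mono: "mono_on {s..t} \<mu>" and pos: "0 < \<mu> s"
    and \<rho>: "0 \<le> \<rho>" "\<rho> \<le> 1" and e: "0 < e"
    and x: "continuous_on {s..t} x" and inside: "\<And>u. u \<in> {s..t} \<Longrightarrow> (x u)\<^sup>2 \<le> (1 - \<rho>) * \<mu> u"
    and eq: "\<And>u. u \<in> {s..t} \<Longrightarrow>
       x u = x0 + integral {s..u} (\<lambda>u. (\<mu> u * x u - (x u) ^ 3) / e) + c * (w u - w s)"
  shows "(\<lambda>n. euler (grid_drift \<mu> \<rho> e s t n) c x0 n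
            (\<lambda>k. w (grid s t n (Suc k)) - w (grid s t n k))) \<longlonglongrightarrow> x t"
proof (rule LIMSEQ_I)
  fix \<delta> :: real assume \<delta>: "0 < \<delta>"
  define D where "D = 4 * \<mu> t * (t - s) / e"
  have M: "0 < \<mu> u \<and> \<mu> u \<le> \<mu> t" if "u \<in> {s..t}" for u
    using mono_onD[OF mono, of s u] mono_onD[OF mono, of u t] that pos by auto
  have D: "0 < D" unfolding D_def using M[of t] st e by simp
  \<comment> \<open>Chosen so that the Gronwall bound \<open>\<kappa> * D * exp D\<close> equals
    \<open>\<delta> / 2\<close>, where \<open>D\<close> is the Lipschitz constant accumulated over
    \<open>{s..t}\<close>.\<close>
  define \<kappa> where "\<kappa> = \<delta> / (2 * D * exp D)"
  have \<kappa>: "0 < \<kappa>" unfolding \<kappa>_def using \<delta> D by simp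
  have "uniformly_continuous_on {s..t} x"
    using x by (intro compact_uniformly_continuous) auto
  then obtain d where d: "0 < d"
    "\<And>u v. u \<in> {s..t} \<Longrightarrow> v \<in> {s..t} \<Longrightarrow> dist v u < d \<Longrightarrow> dist (x v) (x u) < \<kappa>"
    unfolding uniformly_continuous_on_def using \<kappa> by meson
  obtain N where N: "real N > (t - s) / d" using reals_Archimedean2 by blast
  have N0: "0 < N" using N d st by (cases N) (auto simp: field_simps)
  show "\<exists>no. \<forall>n\<ge>no. norm (euler (grid_drift \<mu> \<rho> e s t n) c x0 n
            (\<lambda>k. w (grid s t n (Suc k)) - w (grid s t n k)) - x t) < \<delta>"
  proof (intro exI allI impI)
    fix n assume "N \<le> n"
    then have n: "0 < n" and "(t - s) / d < real n" using N N0 by auto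
    then have hd: "(t - s) / real n < d" using d by (simp add: field_simps)
    define h where "h = (t - s) / real n"
    have h: "0 < h" unfolding h_def using st n by simp
    have nh: "t - s = real n * h" unfolding h_def using n by simp
    define y where "y k = euler (grid_drift \<mu> \<rho> e s t n) c x0 k
      (\<lambda>k. w (grid s t n (Suc k)) - w (grid s t n k))" for k
    let ?g = "grid s t n"
    let ?f = "\<lambda>u. (\<mu> u * x u - (x u) ^ 3) / e"
    have "\<bar>x (?g n) - y n\<bar> \<le> real n * (4 * \<mu> t * \<kappa> / e * h) * exp (real n * (4 * \<mu> t / e * h))"
    proof (rule discrete_gronwall[where e = "\<lambda>k. \<bar>x (?g k) - y k\<bar>"])
      show "\<bar>x (?g 0) - y 0\<bar> \<le> 0" unfolding grid_0 y_def using eq[of s] st by simp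
      show "0 \<le> 4 * \<mu> t / e * h" "0 \<le> 4 * \<mu> t * \<kappa> / e * h" using M[of t] st e h \<kappa> by auto
      fix k assume k: "k < n"
      note gi = grid_integral_bounds[OF st k mono]
      have gk: "?g k \<in> {s..t}" "?g (Suc k) \<in> {s..t}" using grid_mem[of s t] st k by auto
      have fint: "?f integrable_on {s..?g (Suc k)}"
      proof -
        have sub: "{s..?g (Suc k)} \<subseteq> {s..t}" using gk by auto
        show ?thesis
          using mono_on_subset[OF mono sub] continuous_on_subset[OF x sub]
          by (intro integrable_on_divide integrable_diff mono_on_mult_continuous_integrable
                integrable_continuous_real continuous_intros)
      qed
      have comb: "integral {s..?g k} ?f + integral {?g k..?g (Suc k)} ?f = integral {s..?g (Suc k)} ?f"
        using gk fint h by (intro Henstock_Kurzweil_Integration.integral_combine) (auto simp: grid_Suc h_def)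
      \<comment> \<open>The difference of the integral equation at consecutive grid points, with the
        same noise term as in \<open>yS\<close>.\<close>
      have xS: "x (?g (Suc k)) = x (?g k) + integral {?g k..?g (Suc k)} ?f + c * (w (?g (Suc k)) - w (?g k))"
        using eq[OF gk(1)] eq[OF gk(2)] comb by (simp add: algebra_simps)
      have yS: "y (Suc k) = y k + grid_drift \<mu> \<rho> e s t n k (y k) + c * (w (?g (Suc k)) - w (?g k))"
        by (simp add: y_def)
      have loc: "\<bar>integral {?g k..?g (Suc k)} ?f - grid_drift \<mu> \<rho> e s t n k (x (?g k))\<bar>
          \<le> 4 * \<mu> t * \<kappa> / e * h"
        unfolding h_def
      proof (rule grid_drift_local_error[OF st k mono pos \<rho> e x inside])
        fix u v assume "u \<in> {s..t}" "v \<in> {s..t}" "\<bar>u - v\<bar> \<le> (t - s) / real n"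
        then show "\<bar>x u - x v\<bar> \<le> \<kappa>" using d(2)[of v u] hd by (simp add: dist_real_def)
      qed
      let ?a = "integral {?g k..?g (Suc k)} \<mu>"
      have a: "0 \<le> ?a" "h * ((1 - \<rho>) * \<mu> (?g k)) \<le> (1 - \<rho>) * ?a"
        using gi(3) M[OF gk(1)] h \<rho> mult_left_mono[OF gi(3), of "1 - \<rho>"] unfolding h_def[symmetric]
        by (auto simp: algebra_simps intro: order_trans[of 0 "h * \<mu> (?g k)"])
      have "\<bar>grid_drift \<mu> \<rho> e s t n k (x (?g k)) - grid_drift \<mu> \<rho> e s t n k (y k)\<bar>
          \<le> 4 * ?a * \<bar>x (?g k) - y k\<bar> / e"
        unfolding grid_drift_def diff_divide_distrib[symmetric] h_def[symmetric] abs_divide abs_of_pos[OF e]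
        using a M[OF gk(1)] \<rho> h e by (intro divide_right_mono trunc_drift_lipschitz) auto
      also have "\<dots> \<le> 4 * (h * \<mu> t) * \<bar>x (?g k) - y k\<bar> / e"
        using gi(4) e unfolding h_def[symmetric] by (intro divide_right_mono mult_right_mono mult_left_mono) auto
      finally have "\<bar>grid_drift \<mu> \<rho> e s t n k (x (?g k)) - grid_drift \<mu> \<rho> e s t n k (y k)\<bar>
          \<le> 4 * \<mu> t / e * h * \<bar>x (?g k) - y k\<bar>" by (simp add: mult_ac)
      with loc show "\<bar>x (?g (Suc k)) - y (Suc k)\<bar>
          \<le> (1 + 4 * \<mu> t / e * h) * \<bar>x (?g k) - y k\<bar> + 4 * \<mu> t * \<kappa> / e * h"
        unfolding xS yS distrib_right mult_1 by linarith
    qed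
    also have "real n * (4 * \<mu> t * \<kappa> / e * h) = \<kappa> * D"
      unfolding D_def nh by (simp add: mult_ac)
    also have "real n * (4 * \<mu> t / e * h) = D"
      unfolding D_def nh by (simp add: mult_ac)
    also have "\<kappa> * D * exp D = \<delta> / 2" unfolding \<kappa>_def using D by simp
    finally show "norm (euler (grid_drift \<mu> \<rho> e s t n) c x0 n
            (\<lambda>k. w (?g (Suc k)) - w (?g k)) - x t) < \<delta>"
      using \<delta> n by (simp add: grid_n y_def abs_minus_commute)
  qed
qed

section \<open>Small-ball bound for the scheme driven by Brownian motion\<close>

text \<open>Bounding each weight \<open>\<rho> * a j / e\<close> in
  \<open>sum_inverse_prod_lower\<close> by its maximum \<open>\<rho> * (h * m) / e\<close> gives a
  lower bound for the unweighted sum. The resulting \<open>sqrt m\<close> joins the one already in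
  the numerator, which is why \<open>m\<close> appears to the first power.\<close>

lemma euler_variance_bound:
  fixes a :: "nat \<Rightarrow> real"
  assumes a: "\<And>k. k < n \<Longrightarrow> 0 < a k" "\<And>k. k < n \<Longrightarrow> a k \<le> h * m"
    and pos: "0 < \<rho>" "0 < m" "0 < e" "0 < \<sigma>" "0 < h" "0 < n" and small: "\<rho> * (h * m) / e \<le> 1"
  defines "R \<equiv> \<lambda>k. \<Prod>i<k. 1 + \<rho> * a i / e"
  shows "sqrt m / (R n * sqrt ((\<sigma> / sqrt e)\<^sup>2 * h * (\<Sum>j<n. 1 / (R (Suc j))\<^sup>2)))
    \<le> sqrt (3 * \<rho>) * m / \<sigma> / sqrt ((R n)\<^sup>2 - 1)"
proof -
  let ?S = "\<Sum>j<n. 1 / (R (Suc j))\<^sup>2"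
  let ?p = "\<lambda>j. \<rho> * a j / e"
  have p: "0 < ?p k" "?p k \<le> \<rho> * (h * m) / e" if "k < n" for k
    using a[OF that] pos by (auto intro!: divide_right_mono mult_left_mono)
  have R1: "1 < R n"
    unfolding R_def using pos p by (intro less_1_prod) auto
  then have R2: "1 < (R n)\<^sup>2" by (simp add: one_less_power)
  have "(1 - 1 / (R n)\<^sup>2) / 3 \<le> (\<Sum>j<n. ?p j / (R (Suc j))\<^sup>2)"
    unfolding R_def
  proof (rule sum_inverse_prod_lower)
    show "0 \<le> ?p i" "?p i \<le> 1" if "i < n" for i using p[OF that] small by linarith+
  qed
  also have "\<dots> \<le> (\<Sum>j<n. \<rho> * (h * m) / e * (1 / (R (Suc j))\<^sup>2))"
  proof (rule sum_mono)
    fix j assume "j \<in> {..<n}"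
    then have "?p j * (1 / (R (Suc j))\<^sup>2) \<le> \<rho> * (h * m) / e * (1 / (R (Suc j))\<^sup>2)"
      by (intro mult_right_mono p) auto
    then show "?p j / (R (Suc j))\<^sup>2 \<le> \<rho> * (h * m) / e * (1 / (R (Suc j))\<^sup>2)" by simp
  qed
  finally have "(1 - 1 / (R n)\<^sup>2) / 3 \<le> \<rho> * (h * m) / e * ?S"
    unfolding sum_distrib_left .
  then have "\<sigma>\<^sup>2 * (R n)\<^sup>2 / (\<rho> * m) * ((1 - 1 / (R n)\<^sup>2) / 3)
      \<le> \<sigma>\<^sup>2 * (R n)\<^sup>2 / (\<rho> * m) * (\<rho> * (h * m) / e * ?S)"
    using pos by (intro mult_left_mono) auto
  moreover have "\<sigma>\<^sup>2 * (R n)\<^sup>2 / (\<rho> * m) * ((1 - 1 / (R n)\<^sup>2) / 3) = \<sigma>\<^sup>2 * ((R n)\<^sup>2 - 1) / (3 * \<rho> * m)"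
    using pos R1 by (simp add: field_simps)
  moreover have "\<sigma>\<^sup>2 * (R n)\<^sup>2 / (\<rho> * m) * (\<rho> * (h * m) / e * ?S)
      = (R n)\<^sup>2 * ((\<sigma> / sqrt e)\<^sup>2 * h * ?S)"
    using pos by (simp add: power_divide)
  ultimately have "\<sigma>\<^sup>2 * ((R n)\<^sup>2 - 1) / (3 * \<rho> * m) \<le> (R n)\<^sup>2 * ((\<sigma> / sqrt e)\<^sup>2 * h * ?S)"
    by simp
  then have "sqrt (\<sigma>\<^sup>2 * ((R n)\<^sup>2 - 1) / (3 * \<rho> * m)) \<le> sqrt ((R n)\<^sup>2 * ((\<sigma> / sqrt e)\<^sup>2 * h * ?S))"
    by (rule real_sqrt_le_mono)
  also have "\<dots> = R n * sqrt ((\<sigma> / sqrt e)\<^sup>2 * h * ?S)"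
    unfolding real_sqrt_mult[of "(R n)\<^sup>2"] using R1 by simp
  finally have le: "sqrt (\<sigma>\<^sup>2 * ((R n)\<^sup>2 - 1) / (3 * \<rho> * m)) \<le> R n * sqrt ((\<sigma> / sqrt e)\<^sup>2 * h * ?S)" .
  have Q: "0 < sqrt (\<sigma>\<^sup>2 * ((R n)\<^sup>2 - 1) / (3 * \<rho> * m))" using pos R2 by simp
  have "sqrt m / (R n * sqrt ((\<sigma> / sqrt e)\<^sup>2 * h * ?S))
      \<le> sqrt m / sqrt (\<sigma>\<^sup>2 * ((R n)\<^sup>2 - 1) / (3 * \<rho> * m))"
    using pos by (intro divide_left_mono[OF le] mult_pos_pos[OF less_le_trans[OF Q le] Q]) simp
  also have "\<dots> = sqrt (3 * \<rho>) * (sqrt m * sqrt m) / \<sigma> / sqrt ((R n)\<^sup>2 - 1)"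
    using pos by (simp add: real_sqrt_divide real_sqrt_mult)
  finally show ?thesis using pos by simp
qed

lemma sum_grid_integral:
  fixes \<mu> :: "real \<Rightarrow> real"
  assumes "s < t" "mono_on {s..t} \<mu>" "0 < n"
  shows "(\<Sum>k<n. integral {grid s t n k..grid s t n (Suc k)} \<mu>) = integral {s..t} \<mu>"
proof -
  have "(\<Sum>k<j. integral {grid s t n k..grid s t n (Suc k)} \<mu>) = integral {s..grid s t n j} \<mu>" if "j \<le> n" for j
    using that
  proof (induction j)
    case (Suc j)
    have g: "grid s t n j \<in> {s..t}" "grid s t n (Suc j) \<in> {s..t}"
      using Suc assms by (auto intro!: grid_mem simp del: atLeastAtMost_iff)
    have "mono_on {s..grid s t n (Suc j)} \<mu>"
      using g by (intro mono_on_subset[OF assms(2)]) auto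
    then have "integral {s..grid s t n j} \<mu> + integral {grid s t n j..grid s t n (Suc j)} \<mu>
        = integral {s..grid s t n (Suc j)} \<mu>"
      using g assms by (intro Henstock_Kurzweil_Integration.integral_combine integrable_on_mono_on)
        (auto simp: grid_Suc)
    then show ?case using Suc by simp
  qed (simp add: grid_0)
  from this[of n] show ?thesis using assms by (simp add: grid_n)
qed

lemma mono_on_integral_pos:
  fixes \<mu> :: "real \<Rightarrow> real"
  assumes "s < t" and mono: "mono_on {s..t} \<mu>" and "0 < \<mu> s"
  shows "0 < integral {s..t} \<mu>"
proof -
  have "((\<lambda>u. \<mu> s) has_integral (t - s) * \<mu> s) {s..t}"
    using has_integral_const_real[of "\<mu> s" s t] assms by simp
  then have "(t - s) * \<mu> s \<le> integral {s..t} \<mu>"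
    using integrable_on_mono_on[OF mono] mono_onD[OF mono, of s] assms
    by (auto intro!: has_integral_le[OF _ integrable_integral])
  then show ?thesis using mult_pos_pos[of "t - s" "\<mu> s"] assms by linarith
qed

text \<open>Independence of the increments makes their joint law a product, and on a uniform grid
  all marginals are the same Gaussian. The restriction is needed because points of the product space
  are undefined outside the index set.\<close>

lemma brownian_increment_distr:
  assumes BM: "brownian_motion M W" and s: "0 \<le> s" and st: "s < t" and n: "0 < n"
  defines "Z \<equiv> \<lambda>\<omega> k. W (grid s t n (Suc k)) \<omega> - W (grid s t n k) \<omega>"
  shows "distr M (PiM {..<n} (\<lambda>_. borel)) (\<lambda>\<omega>. restrict (Z \<omega>) {..<n})
     = PiM {..<n} (\<lambda>_. gauss ((t - s) / real n))"
    and "\<And>k. (\<lambda>\<omega>. Z \<omega> k) \<in> borel_measurable M"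
proof -
  interpret prob_space M using BM by (simp add: brownian_motion_def)
  let ?h = "(t - s) / real n"
  have h: "0 < ?h" using st n by simp
  have g: "0 \<le> grid s t n k" for k using s st unfolding grid_def by simp
  have Wm: "W u \<in> borel_measurable M" if "0 \<le> u" for u
    using BM that unfolding brownian_motion_def by blast
  show Zm: "(\<lambda>\<omega>. Z \<omega> k) \<in> borel_measurable M" for k
    unfolding Z_def by (intro borel_measurable_diff Wm g)
  have gS: "grid s t n k < grid s t n (Suc k)" for k
    unfolding grid_Suc using h by simp
  have ind: "indep_vars (\<lambda>_. borel) (\<lambda>k \<omega>. Z \<omega> k) {..<n}"
    unfolding Z_def using BM g gS unfolding brownian_motion_def by blast
  have Zd: "distr M borel (\<lambda>\<omega>. Z \<omega> k) = gauss ?h" for k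
  proof -
    have "grid s t n (Suc k) - grid s t n k = ?h" by (simp add: grid_Suc)
    then have "distributed M lborel (\<lambda>\<omega>. Z \<omega> k) (\<lambda>y. ennreal (normal_density 0 (sqrt ?h) y))"
      using BM g[of k] gS[of k] unfolding brownian_motion_def Z_def by metis
    then have "distr M lborel (\<lambda>\<omega>. Z \<omega> k) = gauss ?h"
      by (rule distributed_distr_eq_density)
    \<comment> \<open>\<open>lborel\<close> and \<open>borel\<close> have the same sets, so only the
      nominal target space changes.\<close>
    moreover have "distr M lborel (\<lambda>\<omega>. Z \<omega> k) = distr M borel (\<lambda>\<omega>. Z \<omega> k)"
      by (rule distr_cong) auto
    ultimately show ?thesis by simp
  qed
  have "distr M (PiM {..<n} (\<lambda>_. borel)) (\<lambda>\<omega>. restrict (Z \<omega>) {..<n})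
     = PiM {..<n} (\<lambda>k. distr M borel (\<lambda>\<omega>. Z \<omega> k))"
    using ind n by (subst (asm) indep_vars_iff_distr_eq_PiM') (auto simp: Zm)
  then show "distr M (PiM {..<n} (\<lambda>_. borel)) (\<lambda>\<omega>. restrict (Z \<omega>) {..<n})
     = PiM {..<n} (\<lambda>_. gauss ?h)"
    unfolding Zd .
qed

text \<open>The scheme is a measurable function of the restricted increments, so
  \<open>euler_small_ball\<close> carries over through their joint law.\<close>

lemma euler_brownian_small_ball:
  fixes B :: "nat \<Rightarrow> real \<Rightarrow> real" and r :: "nat \<Rightarrow> real" and x0 :: real
  assumes BM: "brownian_motion M W" and s: "0 \<le> s" and st: "s < t" and n: "0 < n"
    and c: "0 < c" and V: "0 < V" and r: "\<And>k. k < n \<Longrightarrow> 0 < r k"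
    and exp: "\<And>k y. k < n \<Longrightarrow> (r k * y)\<^sup>2 \<le> (y + B k y)\<^sup>2"
    and B: "\<And>k. B k \<in> borel_measurable borel"
  defines "Y \<equiv> \<lambda>\<omega>. euler B c x0 n (\<lambda>k. W (grid s t n (Suc k)) \<omega> - W (grid s t n k) \<omega>)"
    and "R \<equiv> \<lambda>k. \<Prod>i<k. r i"
  shows "Y \<in> borel_measurable M"
    and "measure M {\<omega> \<in> space M. (Y \<omega>)\<^sup>2 \<le> V}
    \<le> exp (1/2) * (sqrt V / (R n * sqrt (c\<^sup>2 * ((t - s) / real n) * (\<Sum>j<n. 1 / (R (Suc j))\<^sup>2))))"
proof -
  interpret prob_space M using BM by (simp add: brownian_motion_def)
  let ?h = "(t - s) / real n"
  have h: "0 < ?h" using st n by simp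
  define Z where "Z \<omega> k = W (grid s t n (Suc k)) \<omega> - W (grid s t n k) \<omega>" for \<omega> k
  let ?P = "PiM {..<n} (\<lambda>_. borel) :: (nat \<Rightarrow> real) measure"
  let ?Q = "PiM {..<n} (\<lambda>_. gauss ?h)"
  note d = brownian_increment_distr[OF BM s st n, folded Z_def]
  have Zm: "(\<lambda>\<omega>. restrict (Z \<omega>) {..<n}) \<in> measurable M ?P"
    using d(2) by (intro measurable_restrict) auto
  have em: "euler B c x0 n \<in> borel_measurable ?P"
    by (rule euler_measurable) (auto simp: B)
  have Y: "Y \<omega> = euler B c x0 n (restrict (Z \<omega>) {..<n})" for \<omega>
    unfolding Y_def by (rule euler_cong) (simp add: Z_def)
  show "Y \<in> borel_measurable M"
    using measurable_compose[OF Zm em] unfolding Y[abs_def] .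
  have sp: "space ?Q = space ?P" by (simp add: space_PiM)
  have "emeasure M {\<omega> \<in> space M. (Y \<omega>)\<^sup>2 \<le> V}
     = emeasure M ((\<lambda>\<omega>. restrict (Z \<omega>) {..<n}) -` {z \<in> space ?P. (euler B c x0 n z)\<^sup>2 \<le> V} \<inter> space M)"
    using measurable_space[OF Zm] by (intro arg_cong[of _ _ "emeasure M"]) (auto simp: Y)
  also have "\<dots> = emeasure (distr M ?P (\<lambda>\<omega>. restrict (Z \<omega>) {..<n})) {z \<in> space ?P. (euler B c x0 n z)\<^sup>2 \<le> V}"
    using em by (intro emeasure_distr[symmetric] Zm) measurable
  also have "\<dots> = emeasure ?Q {z \<in> space ?Q. (euler B c x0 n z)\<^sup>2 \<le> V}"
    unfolding d(1) sp ..
  also have "\<dots> \<le> ennreal (exp (1/2) * sqrt V / (R n * sqrt (c\<^sup>2 * ?h * (\<Sum>j<n. 1 / (R (Suc j))\<^sup>2))))"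
    unfolding R_def by (rule euler_small_ball[OF c h V r exp B n])
  finally have "emeasure M {\<omega> \<in> space M. (Y \<omega>)\<^sup>2 \<le> V} \<le> \<dots>" .
  moreover have "0 \<le> R k" if "k \<le> n" for k
    unfolding R_def using r that by (intro prod_nonneg) (auto intro: less_imp_le)
  ultimately show "measure M {\<omega> \<in> space M. (Y \<omega>)\<^sup>2 \<le> V}
    \<le> exp (1/2) * (sqrt V / (R n * sqrt (c\<^sup>2 * ?h * (\<Sum>j<n. 1 / (R (Suc j))\<^sup>2))))"
    using V st unfolding emeasure_eq_measure
    by (subst (asm) ennreal_le_iff) (auto intro!: divide_nonneg_nonneg mult_nonneg_nonneg sum_nonneg)
qed

text \<open>The comparison factors are \<open>1 + \<rho> * a k / e\<close>; \<open>\<delta>\<close>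
  measures the loss in replacing their product by an exponential, and vanishes as \<open>n\<close>
  grows. The level is \<open>\<mu> t\<close> rather than the smaller
  \<open>(1 - \<rho>) * \<mu> t\<close>, leaving a margin for the error of the scheme.\<close>

lemma grid_euler_small_ball:
  fixes x0 :: real
  assumes BM: "brownian_motion M W" and s: "0 \<le> s" and st: "s < t" and n: "0 < n"
    and mono: "mono_on {s..t} \<mu>" and pos: "0 < \<mu> s"
    and \<rho>: "0 < \<rho>" "\<rho> \<le> 1" and e: "0 < e" and \<sigma>: "0 < \<sigma>"
    and small: "\<rho> * ((t - s) * \<mu> t) / e < real n"
  defines "Y \<equiv> \<lambda>\<omega>. euler (grid_drift \<mu> \<rho> e s t n) (\<sigma> / sqrt e) x0 n
       (\<lambda>k. W (grid s t n (Suc k)) \<omega> - W (grid s t n k) \<omega>)"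
    and "\<delta> \<equiv> \<rho> * ((t - s) * \<mu> t) / e / real n"
  shows "Y \<in> borel_measurable M"
    and "measure M {\<omega> \<in> space M. (Y \<omega>)\<^sup>2 \<le> \<mu> t}
    \<le> exp (1/2) * (sqrt (3 * \<rho>) * \<mu> t / \<sigma> /
         sqrt (exp (2 * ((1 - \<delta>) * (\<rho> * integral {s..t} \<mu> / e))) - 1))"
proof -
  define h where "h = (t - s) / real n"
  define a where "a k = integral {grid s t n k..grid s t n (Suc k)} \<mu>" for k
  define r where "r k = 1 + \<rho> * a k / e" for k
  define R where "R k = (\<Prod>i<k. r i)" for k
  have h: "0 < h" unfolding h_def using st n by simp
  have M: "0 < \<mu> u \<and> \<mu> u \<le> \<mu> t" if "u \<in> {s..t}" for u
    using mono_onD[OF mono, of s u] mono_onD[OF mono, of u t] that pos by auto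
  have gk: "0 < \<mu> (grid s t n k)" if "k < n" for k
    using M grid_mem[of s t k n] that st n by (simp del: atLeastAtMost_iff)
  have a: "h * \<mu> (grid s t n k) \<le> a k" "a k \<le> h * \<mu> t" if "k < n" for k
    using grid_integral_bounds[OF st that mono] unfolding a_def h_def by auto
  have a0: "0 < a k" if "k < n" for k
    using a(1)[OF that] mult_pos_pos[OF h gk[OF that]] by simp
  have r0: "0 < r k" if "k < n" for k
    unfolding r_def using a0[OF that] \<rho> e by (simp add: add_pos_pos)
  have \<delta>: "\<rho> * (h * \<mu> t) / e = \<delta>" "\<delta> < 1"
    unfolding h_def \<delta>_def using n small by (simp_all only: divide_less_eq_1_pos of_nat_0_less_iff) simp
  have exp: "(r k * y)\<^sup>2 \<le> (y + grid_drift \<mu> \<rho> e s t n k y)\<^sup>2" if k: "k < n" for k y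
    unfolding r_def grid_drift_def a_def[symmetric] h_def[symmetric]
  proof (rule trunc_drift_expanding)
    have "(1 - \<rho>) * (h * \<mu> (grid s t n k)) \<le> (1 - \<rho>) * a k"
      using a(1)[OF k] \<rho> by (intro mult_left_mono) auto
    then show "h * (sqrt ((1 - \<rho>) * \<mu> (grid s t n k)))\<^sup>2 \<le> (1 - \<rho>) * a k"
      using \<rho> gk[OF k] by (simp add: mult_ac)
  qed (use \<rho> e h gk[OF k] a0[OF k] in auto)
  have Bm: "grid_drift \<mu> \<rho> e s t n k \<in> borel_measurable borel" for k
    unfolding grid_drift_def[abs_def]
    by (intro borel_measurable_divide trunc_drift_measurable borel_measurable_const)
  have c: "0 < \<sigma> / sqrt e" using \<sigma> e by simp
  have V: "0 < \<mu> t" using M st by simp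
  show "Y \<in> borel_measurable M"
    unfolding Y_def by (rule euler_brownian_small_ball(1)[OF BM s st n c V r0 exp Bm])
  have sb: "measure M {\<omega> \<in> space M. (Y \<omega>)\<^sup>2 \<le> \<mu> t} \<le> exp (1/2) *
      (sqrt (\<mu> t) / (R n * sqrt ((\<sigma> / sqrt e)\<^sup>2 * h * (\<Sum>j<n. 1 / (R (Suc j))\<^sup>2))))"
    unfolding Y_def R_def h_def by (rule euler_brownian_small_ball(2)[OF BM s st n c V r0 exp Bm])
  have "exp ((1 - \<delta>) * (\<Sum>i<n. \<rho> * a i / e)) \<le> R n"
    unfolding R_def r_def
  proof (rule prod_one_plus_ge_exp)
    fix i assume i: "i < n"
    show "0 \<le> \<rho> * a i / e" using a0[OF i] \<rho> e by simp
    show "\<rho> * a i / e \<le> \<delta>"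
      unfolding \<delta>(1)[symmetric] using a[OF i] \<rho> e by (intro divide_right_mono mult_left_mono) auto
  qed (use \<delta> in simp)
  also have "(\<Sum>i<n. \<rho> * a i / e) = \<rho> * integral {s..t} \<mu> / e"
    using sum_grid_integral[OF st mono n]
    by (simp add: a_def sum_divide_distrib[symmetric] sum_distrib_left[symmetric])
  finally have "(exp ((1 - \<delta>) * (\<rho> * integral {s..t} \<mu> / e)))\<^sup>2 \<le> (R n)\<^sup>2"
    by (intro power_mono) auto
  then have R: "exp (2 * ((1 - \<delta>) * (\<rho> * integral {s..t} \<mu> / e))) \<le> (R n)\<^sup>2"
    by (simp only: exp_double)
  have pe: "1 < exp (2 * ((1 - \<delta>) * (\<rho> * integral {s..t} \<mu> / e)))"
    using mono_on_integral_pos[OF st mono pos] \<delta>(2) \<rho> e by simp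
  have "sqrt (\<mu> t) / (R n * sqrt ((\<sigma> / sqrt e)\<^sup>2 * h * (\<Sum>j<n. 1 / (R (Suc j))\<^sup>2)))
    \<le> sqrt (3 * \<rho>) * \<mu> t / \<sigma> / sqrt ((R n)\<^sup>2 - 1)"
    unfolding R_def r_def
    using a a0 \<rho> V e \<sigma> h n \<delta> by (intro euler_variance_bound) auto
  also have "\<dots> \<le> sqrt (3 * \<rho>) * \<mu> t / \<sigma> /
         sqrt (exp (2 * ((1 - \<delta>) * (\<rho> * integral {s..t} \<mu> / e))) - 1)"
    using R pe less_le_trans[OF pe R] \<rho> V \<sigma> by (intro divide_left_mono mult_pos_pos) auto
  finally show "measure M {\<omega> \<in> space M. (Y \<omega>)\<^sup>2 \<le> \<mu> t}
    \<le> exp (1/2) * (sqrt (3 * \<rho>) * \<mu> t / \<sigma> /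
         sqrt (exp (2 * ((1 - \<delta>) * (\<rho> * integral {s..t} \<mu> / e))) - 1))"
    by (intro order_trans[OF sb] mult_left_mono) auto
qed

section \<open>Passage from the scheme to the solution\<close>

text \<open>A confined path ends strictly inside the ball of radius \<open>sqrt (\<mu> t)\<close>,
  so the scheme ends in that ball too unless its error exceeds a fixed margin. The probability of
  the latter event tends to 0, and the small-ball bound passes to the limit.\<close>

lemma confined_path_prob_bound:
  assumes BM: "brownian_motion M W" and s: "0 \<le> s" and st: "s < t"
    and mono: "mono_on {s..t} \<mu>" and pos: "0 < \<mu> s"
    and \<rho>: "0 < \<rho>" "\<rho> \<le> 1" and e: "0 < e" and \<sigma>: "0 < \<sigma>"
    and xm: "x t \<in> borel_measurable M" and E: "E \<in> sets M"
    and cont: "\<And>\<omega>. \<omega> \<in> E \<Longrightarrow> continuous_on {s..t} (\<lambda>u. x u \<omega>)"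
    and inside: "\<And>\<omega> u. \<omega> \<in> E \<Longrightarrow> u \<in> {s..t} \<Longrightarrow> (x u \<omega>)\<^sup>2 \<le> (1 - \<rho>) * \<mu> u"
    and eq: "\<And>\<omega> u. \<omega> \<in> E \<Longrightarrow> u \<in> {s..t} \<Longrightarrow> x u \<omega> = x0 +
      integral {s..u} (\<lambda>u. (\<mu> u * x u \<omega> - (x u \<omega>) ^ 3) / e) + \<sigma> / sqrt e * (W u \<omega> - W s \<omega>)"
  shows "measure M E \<le> exp (1/2) * (sqrt (3 * \<rho>) * \<mu> t / \<sigma> /
         sqrt (exp (2 * (\<rho> * integral {s..t} \<mu> / e)) - 1))"
proof -
  interpret prob_space M using BM by (simp add: brownian_motion_def)
  define Y where "Y n \<omega> = euler (grid_drift \<mu> \<rho> e s t n) (\<sigma> / sqrt e) x0 n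
       (\<lambda>k. W (grid s t n (Suc k)) \<omega> - W (grid s t n k) \<omega>)" for n \<omega>
  define C where "C = \<rho> * ((t - s) * \<mu> t) / e"
  define F where "F \<delta> = exp (1/2) * (sqrt (3 * \<rho>) * \<mu> t / \<sigma> /
         sqrt (exp (2 * ((1 - \<delta>) * (\<rho> * integral {s..t} \<mu> / e))) - 1))" for \<delta>
  obtain N where N: "real N > C" using reals_Archimedean2 by blast
  have V: "0 < \<mu> t" using mono_onD[OF mono, of s t] st pos by simp
  then have C: "0 < C" unfolding C_def using \<rho> st e by simp
  then have N0: "0 < N" using N by (cases N) auto
  have n: "0 < n" "C < real n" if "N \<le> n" for n using that N N0 by auto
  have Ym: "Y n \<in> borel_measurable M"
    and Yb: "measure M {\<omega> \<in> space M. (Y n \<omega>)\<^sup>2 \<le> \<mu> t} \<le> F (C / real n)" if "N \<le> n" for n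
    using grid_euler_small_ball[OF BM s st n(1)[OF that] mono pos \<rho> e \<sigma> n(2)[OF that, unfolded C_def], of x0]
    unfolding Y_def[abs_def] F_def C_def by blast+
  define \<delta> where "\<delta> = sqrt (\<mu> t) - sqrt ((1 - \<rho>) * \<mu> t)"
  have "(1 - \<rho>) * \<mu> t < 1 * \<mu> t" using \<rho> V by (intro mult_strict_right_mono) auto
  then have \<delta>: "0 < \<delta>" unfolding \<delta>_def by simp
  \<comment> \<open>The bad event is intersected with \<open>E\<close> because convergence of the
    scheme is known only for confined paths.\<close>
  define G where "G n = {\<omega> \<in> space M. \<omega> \<in> E \<and> \<delta> < \<bar>Y n \<omega> - x t \<omega>\<bar>}" for n
  have Gs: "G n \<in> sets M" if "N \<le> n" for n
    using Ym[OF that] xm E unfolding G_def by measurable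
  have bound: "measure M E \<le> F (C / real n) + measure M (G n)" if "N \<le> n" for n
  proof -
    have "E \<subseteq> {\<omega> \<in> space M. (Y n \<omega>)\<^sup>2 \<le> \<mu> t} \<union> G n"
    proof
      fix \<omega> assume \<omega>: "\<omega> \<in> E"
      have sp: "\<omega> \<in> space M" using \<omega> E sets.sets_into_space by blast
      have "(x t \<omega>)\<^sup>2 \<le> (1 - \<rho>) * \<mu> t" using inside[OF \<omega>] st by simp
      then have "\<bar>x t \<omega>\<bar> \<le> sqrt ((1 - \<rho>) * \<mu> t)" by (metis real_sqrt_abs real_sqrt_le_iff)
      then have "\<bar>Y n \<omega>\<bar> \<le> sqrt (\<mu> t)" if "\<bar>Y n \<omega> - x t \<omega>\<bar> \<le> \<delta>"
        using that unfolding \<delta>_def by linarith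
      then have "(Y n \<omega>)\<^sup>2 \<le> \<mu> t" if "\<bar>Y n \<omega> - x t \<omega>\<bar> \<le> \<delta>"
        using that sqrt_ge_absD by blast
      then show "\<omega> \<in> {\<omega> \<in> space M. (Y n \<omega>)\<^sup>2 \<le> \<mu> t} \<union> G n"
        unfolding G_def using \<omega> sp by force
    qed
    then have "measure M E \<le> measure M ({\<omega> \<in> space M. (Y n \<omega>)\<^sup>2 \<le> \<mu> t} \<union> G n)"
      using Ym[OF that] Gs[OF that] by (intro finite_measure_mono) measurable
    also have "\<dots> \<le> measure M {\<omega> \<in> space M. (Y n \<omega>)\<^sup>2 \<le> \<mu> t} + measure M (G n)"
      using Ym[OF that] Gs[OF that] by (intro measure_Un_le) measurable
    finally show ?thesis using Yb[OF that] by simp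
  qed
  \<comment> \<open>Convergence for each outcome suffices, by dominated convergence of indicators.
    The shift by \<open>N\<close> restricts to grids on which \<open>Y n\<close> is known to be
    measurable.\<close>
  have "(\<lambda>n. measure M (G (n + N))) \<longlonglongrightarrow> 0"
  proof -
    have "(\<lambda>n. \<integral>\<omega>. indicator (G (n + N)) \<omega> \<partial>M) \<longlonglongrightarrow> (\<integral>\<omega>. (0::real) \<partial>M)"
    proof (rule integral_dominated_convergence[where w = "\<lambda>_. 1"])
      show "AE \<omega> in M. (\<lambda>n. indicator (G (n + N)) \<omega> :: real) \<longlonglongrightarrow> 0"
      proof (rule AE_I2)
        fix \<omega> assume "\<omega> \<in> space M"
        show "(\<lambda>n. indicator (G (n + N)) \<omega> :: real) \<longlonglongrightarrow> 0"
        proof (cases "\<omega> \<in> E")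
          case True
          have "(\<lambda>n. Y n \<omega>) \<longlonglongrightarrow> x t \<omega>"
            unfolding Y_def
            by (rule euler_grid_convergence[OF st mono pos less_imp_le[OF \<rho>(1)] \<rho>(2) e cont[OF True] inside[OF True] eq[OF True]])
          then have "\<forall>\<^sub>F n in sequentially. \<bar>Y n \<omega> - x t \<omega>\<bar> < \<delta>"
            using \<delta> by (auto simp: tendsto_iff dist_real_def)
          then have "\<forall>\<^sub>F n in sequentially. \<bar>Y (n + N) \<omega> - x t \<omega>\<bar> < \<delta>"
            by (rule sequentially_offset)
          then have "\<forall>\<^sub>F n in sequentially. indicator (G (n + N)) \<omega> = (0::real)"
            by eventually_elim (auto simp: G_def)
          then show ?thesis by (rule tendsto_eventually)
        qed (simp add: G_def)
      qed
    qed (use Gs in \<open>auto split: split_indicator\<close>)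
    then show ?thesis using Gs by simp
  qed
  moreover have "(\<lambda>n. F (C / real (n + N))) \<longlonglongrightarrow> F 0"
  proof -
    have "(\<lambda>n. C / real (n + N)) \<longlonglongrightarrow> 0"
      by (rule LIMSEQ_ignore_initial_segment[where f = "\<lambda>n. C / real n"]) (rule lim_const_over_n)
    \<comment> \<open>Keeps the denominator of \<open>F\<close> away from 0 at
      \<open>\<delta> = 0\<close>, so \<open>F\<close> is continuous there.\<close>
    moreover have "1 < exp (2 * ((1 - 0) * (\<rho> * integral {s..t} \<mu> / e)))"
      using mono_on_integral_pos[OF st mono pos] \<rho> e by simp
    ultimately show ?thesis unfolding F_def using \<sigma>
      by (intro tendsto_intros) auto
  qed
  ultimately have "(\<lambda>n. F (C / real (n + N)) + measure M (G (n + N))) \<longlonglongrightarrow> F 0 + 0"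
    by (intro tendsto_add)
  then have "measure M E \<le> F 0 + 0"
    by (rule LIMSEQ_le_const) (intro exI[of _ 0] allI impI, rule bound, simp)
  then show ?thesis unfolding F_def by simp
qed

section \<open>The exit-time estimate\<close>

theorem theorem5p1:
  fixes \<mu> :: "real \<Rightarrow> real" and t0 T :: real
  assumes "t0 < 0" and "0 < T"
    and "mono_on {t0..T} \<mu>"
    and "\<exists>L. \<forall>t\<in>{t0..T}. \<bar>\<mu> t - t\<bar> \<le> L * t\<^sup>2"
  shows "\<forall>K>0. \<forall>\<rho>. 0 < \<rho> \<and> \<rho> < 2/3 \<longrightarrow>
    (\<exists>c>0. \<exists>eps0>0. \<forall>eps sig. 0 < eps \<and> eps \<le> eps0 \<and> 0 < sig \<and> sig \<le> eps0 \<and>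
        sig * \<bar>ln sig\<bar> powr (3/2) \<le> K * sqrt eps \<longrightarrow>
      (\<forall>(M::'a measure) W x x0 t.
         brownian_motion M W \<and>
         sde_solution M W \<mu> eps sig (sqrt eps) T x0 x \<and>
         (x0, sqrt eps) \<in> D_set eps T \<mu> \<rho> \<and>
         sqrt eps < t \<and> t \<le> T \<longrightarrow>
         measure M {\<omega>\<in>space M. ereal t \<le> first_exit_time (D_set eps T \<mu> \<rho>) (sqrt eps) x \<omega>}
           \<le> c * \<mu> t * (1 + alpha \<mu> t (sqrt eps) / eps) * (\<bar>ln sig\<bar> / sig)
              * exp (- \<rho> * alpha \<mu> t (sqrt eps) / eps)
              / sqrt (1 - exp (- 2 * \<rho> * alpha \<mu> t (sqrt eps) / eps))))"
proof (intro allI impI)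
  fix K \<rho> :: real
  assume "0 < K" and \<rho>': "0 < \<rho> \<and> \<rho> < 2/3"
  then have \<rho>: "0 < \<rho>" "\<rho> \<le> 1" "\<rho> < 1" by auto
  obtain L where L: "\<And>u. u \<in> {t0..T} \<Longrightarrow> \<bar>\<mu> u - u\<bar> \<le> L * u\<^sup>2" using assms(4) by blast
  define c where "c = exp (1/2) * sqrt (3 * \<rho>)"
  \<comment> \<open>The bound \<open>exp (-1)\<close> yields
    \<open>\<bar>ln sig\<bar> \<ge> 1\<close>. The bound
    \<open>1 / (1 + \<bar>L\<bar>)\<^sup>2\<close> makes
    \<open>\<bar>L\<bar> * sqrt eps < 1\<close>, so the quadratic error cannot cancel the linear
    term and \<open>\<mu>\<close> is positive from time \<open>sqrt eps\<close> on.\<close>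
  define eps0 where "eps0 = min (exp (-1)) (1 / (1 + \<bar>L\<bar>)\<^sup>2)"
  have c: "0 < c" unfolding c_def using \<rho> by simp
  have eps0: "0 < eps0" unfolding eps0_def by (auto intro!: divide_pos_pos zero_less_power)
  have "measure M {\<omega>\<in>space M. ereal t \<le> first_exit_time (D_set eps T \<mu> \<rho>) (sqrt eps) x \<omega>}
           \<le> c * \<mu> t * (1 + alpha \<mu> t (sqrt eps) / eps) * (\<bar>ln sig\<bar> / sig)
              * exp (- \<rho> * alpha \<mu> t (sqrt eps) / eps)
              / sqrt (1 - exp (- 2 * \<rho> * alpha \<mu> t (sqrt eps) / eps))" (is "measure M ?E \<le> ?rhs")
    if small: "0 < eps" "eps \<le> eps0" "0 < sig" "sig \<le> eps0"
      and BM: "brownian_motion M W" and sol: "sde_solution M W \<mu> eps sig (sqrt eps) T x0 x"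
      and t: "sqrt eps < t" "t \<le> T"
    for eps sig x0 t and M :: "'a measure" and W x
  proof -
    define s where "s = sqrt eps"
    have "0 < s" "s < t" unfolding s_def using small(1) t(1) by simp_all
    then have s: "0 < s" "s < t" "s \<in> {t0..T}" using t(2) assms(1) by auto
    have "sqrt eps \<le> sqrt (1 / (1 + \<bar>L\<bar>)\<^sup>2)" using small unfolding eps0_def by (intro real_sqrt_le_mono) simp
    then have "s \<le> 1 / (1 + \<bar>L\<bar>)" unfolding s_def by (simp add: real_sqrt_divide)
    then have "s + \<bar>L\<bar> * s \<le> 1" by (simp add: field_simps split: if_splits)
    then have "\<bar>L\<bar> * s < 1" using s by linarith
    then have "\<bar>L\<bar> * s * s < s" using mult_strict_right_mono[OF _ s(1), of "\<bar>L\<bar> * s" 1] by simp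
    moreover have "L * s\<^sup>2 \<le> \<bar>L\<bar> * s * s" by (simp add: power2_eq_square mult_right_mono mult.assoc)
    ultimately have \<mu>s: "0 < \<mu> s" using L[OF s(3)] by linarith
    have sub: "{s..t} \<subseteq> {t0..T}" "{s..t} \<subseteq> {s..T}" using s t by auto
    have mono: "mono_on {s..t} \<mu>" by (rule mono_on_subset[OF assms(3) sub(1)])
    have \<mu>t: "0 < \<mu> t" using mono_onD[OF mono, of s t] s \<mu>s by simp
    define A where "A = alpha \<mu> t s"
    have A: "0 < A" unfolding A_def alpha_def by (rule mono_on_integral_pos[OF s(2) mono \<mu>s])
    define b where "b = \<rho> * A / eps"
    have b: "0 < b" unfolding b_def using \<rho> A small by simp
    have ln: "1 \<le> \<bar>ln sig\<bar>"
    proof -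
      have "ln sig \<le> ln (exp (-1))" using small unfolding eps0_def by (subst ln_le_cancel_iff) auto
      then show ?thesis by simp
    qed
    have rhs: "?rhs = c * \<mu> t * (1 + A / eps) * (\<bar>ln sig\<bar> / sig) * exp (- b) / sqrt (1 - exp (- 2 * b))"
      unfolding b_def A_def s_def by simp
    \<comment> \<open>Both factors are at least 1, so the estimate without them implies the stated
      one.\<close>
    have "1 * 1 \<le> (1 + A / eps) * \<bar>ln sig\<bar>"
      using ln A small by (intro mult_mono) auto
    then have "c * \<mu> t / sig * (exp (- b) / sqrt (1 - exp (- 2 * b))) * 1
        \<le> c * \<mu> t / sig * (exp (- b) / sqrt (1 - exp (- 2 * b))) * ((1 + A / eps) * \<bar>ln sig\<bar>)"
      using c \<mu>t small b by (intro mult_left_mono mult_nonneg_nonneg divide_nonneg_nonneg) auto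
    also have "\<dots> = ?rhs" unfolding rhs by simp
    finally have rhs_ge: "c * \<mu> t / sig * (exp (- b) / sqrt (1 - exp (- 2 * b))) \<le> ?rhs" by simp
    have "0 \<le> c * \<mu> t / sig * (exp (- b) / sqrt (1 - exp (- 2 * b)))"
      using c \<mu>t small b by (intro mult_nonneg_nonneg divide_nonneg_nonneg) auto
    then have rhs_nonneg: "0 \<le> ?rhs" using rhs_ge by linarith
    show ?thesis
    \<comment> \<open>The event is defined through uncountably many times. If it is not measurable,
      \<open>measure\<close> takes its default value 0 and nonnegativity of the right-hand side
      suffices.\<close>
    proof (cases "?E \<in> sets M")
      case False
      show ?thesis unfolding measure_notin_sets[OF False] by (rule rhs_nonneg)
    next
      case True
      have cont: "continuous_on {s..t} (\<lambda>u. x u \<omega>)" if "\<omega> \<in> ?E" for \<omega>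
        using sol that continuous_on_subset[OF _ sub(2)] unfolding sde_solution_def s_def by blast
      have before: "\<bar>x u \<omega>\<bar> \<le> sqrt ((1 - \<rho>) * \<mu> u)" if "\<omega> \<in> ?E" "u \<in> {s..<t}" for \<omega> u
      proof (rule ccontr)
        assume "\<not> ?thesis"
        then have "u \<in> {u. sqrt eps \<le> u \<and> (x u \<omega>, u) \<notin> D_set eps T \<mu> \<rho>}"
          using that(2) unfolding D_set_def s_def by auto
        then have "first_exit_time (D_set eps T \<mu> \<rho>) (sqrt eps) x \<omega> \<le> ereal u"
          unfolding first_exit_time_def by (rule INF_lower)
        moreover have "ereal t \<le> first_exit_time (D_set eps T \<mu> \<rho>) (sqrt eps) x \<omega>" using that(1) by simp
        ultimately have "ereal t \<le> ereal u" by (rule order_trans[rotated])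
        then show False using that(2) by simp
      qed
      have inside: "(x u \<omega>)\<^sup>2 \<le> (1 - \<rho>) * \<mu> u" if \<omega>: "\<omega> \<in> ?E" and u: "u \<in> {s..t}" for \<omega> u
      proof -
        have \<mu>u: "0 \<le> (1 - \<rho>) * \<mu> u" using mono_onD[OF mono, of s u] u \<mu>s \<rho> by auto
        have "\<bar>x u \<omega>\<bar> \<le> sqrt ((1 - \<rho>) * \<mu> u)"
        proof (cases "u = t")
          case True
          have cl: "closure {s..<t} = {s..t}" using s by simp
          have "\<bar>x t \<omega>\<bar> \<le> sqrt ((1 - \<rho>) * \<mu> t)"
          \<comment> \<open>The infimum gives confinement only before \<open>t\<close>; the endpoint
            follows by continuity of the path. As \<open>\<mu>\<close> may jump at \<open>t\<close>,
            the earlier bounds are first enlarged to the constant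
            \<open>sqrt ((1 - \<rho>) * \<mu> t)\<close> by monotonicity.\<close>
          proof (rule continuous_le_on_closure[where S = "{s..<t}" and f = "\<lambda>u. \<bar>x u \<omega>\<bar>"])
            show "continuous_on (closure {s..<t}) (\<lambda>u. \<bar>x u \<omega>\<bar>)"
              unfolding cl by (intro continuous_on_rabs cont \<omega>)
            show "t \<in> closure {s..<t}" unfolding cl using s by simp
            fix v assume v: "v \<in> {s..<t}"
            have "sqrt ((1 - \<rho>) * \<mu> v) \<le> sqrt ((1 - \<rho>) * \<mu> t)"
              using mono_onD[OF mono, of v t] v \<rho> by (intro real_sqrt_le_mono mult_left_mono) auto
            then show "\<bar>x v \<omega>\<bar> \<le> sqrt ((1 - \<rho>) * \<mu> t)" using before[OF \<omega> v] by linarith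
          qed
          then show ?thesis using True by simp
        qed (use before[OF \<omega>, of u] u in auto)
        then have "\<bar>x u \<omega>\<bar>\<^sup>2 \<le> (sqrt ((1 - \<rho>) * \<mu> u))\<^sup>2" by (rule power_mono) simp
        then show ?thesis using \<mu>u by simp
      qed
      have "measure M ?E \<le> exp (1/2) * (sqrt (3 * \<rho>) * \<mu> t / sig / sqrt (exp (2 * (\<rho> * integral {s..t} \<mu> / eps)) - 1))"
      proof (rule confined_path_prob_bound[OF BM less_imp_le[OF s(1)] s(2) mono \<mu>s \<rho>(1,2) small(1,3) _ True cont inside])
        show "x t \<in> borel_measurable M" using sol t unfolding sde_solution_def by auto
        show "x u \<omega> = x0 + integral {s..u} (\<lambda>u. (\<mu> u * x u \<omega> - (x u \<omega>) ^ 3) / eps)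
            + sig / sqrt eps * (W u \<omega> - W s \<omega>)" if "\<omega> \<in> ?E" "u \<in> {s..t}" for \<omega> u
          using sol that sub(2) unfolding sde_solution_def s_def by blast
      qed
      also have "\<dots> = c * \<mu> t / sig / sqrt (exp (2 * b) - 1)"
        unfolding c_def b_def A_def alpha_def by simp
      also have "exp (2 * b) - 1 = (exp b)\<^sup>2 * (1 - exp (- 2 * b))"
        by (simp add: right_diff_distrib exp_double[symmetric] exp_add[symmetric])
      also have "c * \<mu> t / sig / sqrt \<dots> = c * \<mu> t / sig * (exp (- b) / sqrt (1 - exp (- 2 * b)))"
        unfolding real_sqrt_mult real_sqrt_abs abs_exp_cancel by (simp add: exp_minus divide_inverse mult_ac)
      finally show ?thesis using rhs_ge by (rule order_trans)
    qed
  qed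
  then show "\<exists>c>0. \<exists>eps0>0. \<forall>eps sig. 0 < eps \<and> eps \<le> eps0 \<and> 0 < sig \<and> sig \<le> eps0 \<and>
        sig * \<bar>ln sig\<bar> powr (3/2) \<le> K * sqrt eps \<longrightarrow>
      (\<forall>(M::'a measure) W x x0 t.
         brownian_motion M W \<and>
         sde_solution M W \<mu> eps sig (sqrt eps) T x0 x \<and>
         (x0, sqrt eps) \<in> D_set eps T \<mu> \<rho> \<and>
         sqrt eps < t \<and> t \<le> T \<longrightarrow>
         measure M {\<omega>\<in>space M. ereal t \<le> first_exit_time (D_set eps T \<mu> \<rho>) (sqrt eps) x \<omega>}
           \<le> c * \<mu> t * (1 + alpha \<mu> t (sqrt eps) / eps) * (\<bar>ln sig\<bar> / sig)
              * exp (- \<rho> * alpha \<mu> t (sqrt eps) / eps)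
              / sqrt (1 - exp (- 2 * \<rho> * alpha \<mu> t (sqrt eps) / eps)))"
    using c eps0 by (intro exI[of _ c] exI[of _ eps0] conjI) blast+
qed

end
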